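(* Consider the non-atomic routing game $(\mathcal G,\Phi)$ on a parallel network and suppose that Assumptions A1 (unique minimum-capacity link on each route), A2 ($\Phi\le\sum_{p=1}^N\overline z_p$) and A3 (distinct $\tau_p^F$ ordered increasingly, distinct $\tau_p^S$) hold. Let $$k:=\min\Bigl\{p\in\{1,\dots,N\}: \Phi-\sum_{i=1}^{p}\overline z_i\le 0\Bigr\},\qquad U:=\bigl\{p\in\{1,\dots,k\}:\tau_p^S\le\tau_i^F\text{ for some }i\le k\bigr\}.$$ (1) If $U=\emptyset$, the game admits a unique fully transferring Wardrop equilibrium $(R^W,x^W)$, such that $$\Phi R_p^W=\begin{cases}\overline z_p,& p=1,\dots,k-1,\\ \Phi-\sum_{i=1}^{k-1}\overline z_i,& p=k,\\ 0,& p=k+1,\dots,N,\end{cases}$$ $$x_p^W=\tau_p^{-1}(\tau_k^F),\ p=1,\dots,k-1,\qquad x_k^W=\Bigl(\tfrac{\Phi-\sum_{i=1}^{k-1}\overline z_i}{v_{1_k}},\dots,\tfrac{\Phi-\sum_{i=1}^{k-1}\overline z_i}{v_{n_k}}\Bigr),$$ and all used routes share the same travel time $\tau_k^F$. (2) If $U\ne\emptyset$, let $u:=\min U$ and let $j:=\min\{p\in\{u+1,\dots,k\}:\tau_p^F\ge\tau_u^S\}$. Then: (2a) If $\tau_j^F>\tau_u^S$, the game admits a unique partially transferring Wardrop equilibrium $(R^W,x^W)$, such that $$\Phi R_p^W=\begin{cases}\overline z_p,& p\in\{1,\dots,j-1\}\setminus\{u\},\\ \Phi-\sum_{i=1,i\ne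 u}^{j-1}\overline z_i,& p=u,\\ 0,& p=j,\dots,N,\end{cases}\qquad x_p^W=\tau_p^{-1}(\tau_u^S),\ p=1,\dots,j-1,$$ and all used routes share the same travel time $\tau_u^S$. (2b) If $\tau_j^F=\tau_u^S$, then the Wardrop equilibrium $(R^W,x^W)$ reads $$\Phi R_p^W=\begin{cases}\overline z_p,& p\in\{1,\dots,j-1\}\setminus\{u\},\\ \Phi R_u^W,& p=u,\\ \Phi\bigl(1-\sum_{i=1}^{j-1}R_i^W\bigr),& p=j,\\ 0,& p=j+1,\dots,N,\end{cases}$$ $$\Phi R_u^W\in\Bigl[\Phi-\sum_{i=1,i\ne u}^{j}\overline z_i,\ \Phi-\sum_{i=1,i\ne u}^{j-1}\overline z_i\Bigr],$$ $$x_p^W=\tau_p^{-1}(\tau_u^S),\ p=1,\dots,j-1,\qquad x_j^W=\Bigl(\tfrac{\Phi(1-\sum_{i=1}^{j-1}R_i^W)}{v_{1_j}},\dots,\tfrac{\Phi(1-\sum_{i=1}^{j-1}R_i^W)}{v_{n_j}}\Bigr).$$ If $j<k$, then $(R^W,x^W)$ is partially transferring, and all used routes share the same travel time $\tau_j^F=\tau_u^S$. If $j=k$, then $(R^W,x^W)$ is fully transferring if and only if $\Phi R_u^W=\overline z_u$, and all used routes share the same travel time $\tau_k^F=\tau_u^S$.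
   Context: Network. A parallel network $\mathcal G$ has $N$ distinct non-intersecting routes $p=1,\dots,N$ from a single origin to a single destination; route $p$ is a sequence of links $1_p,2_p,\dots,n_p$. Each link $l$ has positive finite constants $\overline x_l$ (jam density), $\overline f_l$ (capacity), $v_l$ (free-flow speed), $L_l$ (length). Set $x_l^c:=\overline f_l/v_l$ (critical density) and $w_l:=\overline f_l/(\overline x_l-x_l^c)$. Supply and demand functions: $s_l(x_l)=\min\{\overline f_l,w_l(\overline x_l-x_l)\}$, $d_l(x_l)=\min\{v_lx_l,\overline f_l\}$. The exogenous flow is a constant $\Phi>0$. Flows. A routing vector is $R\in\mathbb R_{\ge0}^N$ with $\sum_pR_p=1$. A density vector is $x=(x_p)_{p=1}^N$ with $x_p=(x_{1_p},\dots,x_{n_p})\in\mathbb R_{\ge0}^{n_p}$. Given $R$ and $x$, put $f_{0_p}(x)=\min\{\Phi R_p,s_{1_p}(x_{1_p})\}$, $f_{l_p}(x)=\min\{d_{l_p}(x_{l_p}),s_{(l+1)_p}(x_{(l+1)_p})\}$ for consecutive links $l_p,(l+1)_p$, and $f_{n_p}(x)=d_{n_p}(x_{n_p})$. The density vector $x$ is consistent with $R$ if $f_{0_p}(x)=f_{1_p}(x)=\dots=f_{n_p}(x)$ for all $p$. A traffic assignment is a pair $(R,x)$ with $R$ a routing vector and $x$ consistent with $R$. Route capacity: $\overline z_p:=\min_{l\in p}\overline f_l$. A traffic assignment $(R,x)$ is partially transferring if $\Phi R_p>\overline z_p$ for some $p$, and fully transferring if there is no such $p$. Assumption A1: each route $p$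 has a unique minimum-capacity link $b_p\in\{1_p,\dots,n_p\}$; $(b-1)_p$ is the link preceding it. Assumption A2: $\Phi\le\sum_{p=1}^N\overline z_p$. Travel times. Link $l$ with density $x_l$ and flow $f_l$ has travel time $\tau_l=L_lx_l/f_l$, equal to the free-flow value $\tau_l^F:=L_l/v_l$ when the link is in free flow (flow equal to $d_l(x_l)$); route $p$ has travel time $\tau_p(x)=\sum_{l\in p}\tau_l(x_l)$. Define $$\tau_p^F:=\sum_{l\in p}\tau_l^F,\qquad \tau_p^S:=\sum_{l=1_p}^{(b-1)_p}\tau_l\Bigl(\overline x_l-\frac{\overline z_p}{w_l}\Bigr)+\sum_{l=b_p}^{n_p}\tau_l^F,$$ where in the first sum the flow on link $l$ is $\overline z_p$. Assumption A3: $\tau_1^F<\tau_2^F<\dots<\tau_N^F$, and $\tau_p^S\ne\tau_q^S$ for $p\ne q$. The map $\tau_p^{-1}$. For $\tau\in[\tau_p^F,\tau_p^S]$, $\tau_p^{-1}(\tau)$ denotes the unique consistent density vector $x_p$ on route $p$ with $\tau_p(x_p)=\tau$ having the following form, for some link $m_p\in\{1_p,\dots,(b-1)_p\}$: $x_{l_p}=\overline z_p/v_{l_p}$ for $l_p=1_p,\dots,(m-1)_p$; $x_{m_p}\in[x_{m_p}^c,\ \overline x_{m_p}-\overline z_p/w_{m_p}]$; $x_{l_p}=\overline x_{l_p}-\overline z_p/w_{l_p}$ for $l_p=(m+1)_p,\dots,(b-1)_p$; $x_{l_p}=\overline z_p/v_{l_p}$ for $l_p=b_p,\dots,n_p$;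 with flow $\overline z_p$ on every link. Wardrop equilibrium of the non-atomic routing game $(\mathcal G,\Phi)$: a traffic assignment $(R^W,x^W)$ such that $R_p^W>0$ implies $\tau_p(x^W)\le\tau_q(x^W)$ for all $q=1,\dots,N$. A route $p$ is used if $R_p^W>0$.
   Formalization: u is the element of U with least τ_p^S (least index fails); in τ_p^{-1}, x_m may go down to z̄_p/v_m; in (1), if Φ=Σ_{i≤k}z̄_i, x is unique only given travel time τ_k^F; (2) excludes U={k}, where j is undefined; x_l^c<x̄_l is assumed; in (2b) only values ΦR_u≥z̄_u are attained. *)

theory Defs
  imports Complex_Main
begin

text \<open>
  Routes are numbered 1, ..., \<open>routes G\<close>, and the links of route \<open>p\<close> are numbered
  1, ..., \<open>links G p\<close> from origin to destination. Vectors indexed by routes or links are functions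
  on \<open>nat\<close> that vanish outside the index range, so that equality of such functions is
  equality of vectors.
\<close>

record network =
  routes :: nat
  links :: "nat \<Rightarrow> nat"
  jam_density :: "nat \<Rightarrow> nat \<Rightarrow> real"
  capacity :: "nat \<Rightarrow> nat \<Rightarrow> real"
  free_speed :: "nat \<Rightarrow> nat \<Rightarrow> real"
  link_length :: "nat \<Rightarrow> nat \<Rightarrow> real"

definition crit_density :: "network \<Rightarrow> nat \<Rightarrow> nat \<Rightarrow> real" where
  "crit_density G p l = capacity G p l / free_speed G p l"

definition wave_speed :: "network \<Rightarrow> nat \<Rightarrow> nat \<Rightarrow> real" where
  "wave_speed G p l = capacity G p l / (jam_density G p l - crit_density G p l)"

text \<open>The condition that the critical density lies below the jam density is what makes
  \<^const>\<open>wave_speed\<close> well defined and positive.\<close>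

definition parallel_network :: "network \<Rightarrow> bool" where
  "parallel_network G \<longleftrightarrow> routes G \<ge> 1 \<and>
     (\<forall>p\<in>{1..routes G}. links G p \<ge> 1 \<and>
        (\<forall>l\<in>{1..links G p}.
           jam_density G p l > 0 \<and> capacity G p l > 0 \<and>
           free_speed G p l > 0 \<and> link_length G p l > 0 \<and>
           crit_density G p l < jam_density G p l))"

definition link_supply :: "network \<Rightarrow> nat \<Rightarrow> nat \<Rightarrow> real \<Rightarrow> real" where
  "link_supply G p l d = min (capacity G p l) (wave_speed G p l * (jam_density G p l - d))"

definition link_demand :: "network \<Rightarrow> nat \<Rightarrow> nat \<Rightarrow> real \<Rightarrow> real" where
  "link_demand G p l d = min (free_speed G p l * d) (capacity G p l)"

definition route_capacity :: "network \<Rightarrow> nat \<Rightarrow> real" where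
  "route_capacity G p = Min (capacity G p ` {1..links G p})"

definition unique_bottlenecks :: "network \<Rightarrow> bool" where
  "unique_bottlenecks G \<longleftrightarrow>
     (\<forall>p\<in>{1..routes G}. \<exists>!b. b \<in> {1..links G p} \<and> capacity G p b = route_capacity G p)"

definition bottleneck :: "network \<Rightarrow> nat \<Rightarrow> nat" where
  "bottleneck G p = (THE b. b \<in> {1..links G p} \<and> capacity G p b = route_capacity G p)"

text \<open>Below, \<open>y\<close> is the density vector of one route and \<open>r\<close> the flow offered to that route,
  i.e. the exogenous flow times the routing ratio.\<close>

definition inflow :: "network \<Rightarrow> nat \<Rightarrow> real \<Rightarrow> (nat \<Rightarrow> real) \<Rightarrow> real" where
  "inflow G p r y = min r (link_supply G p 1 (y 1))"

definition link_flow :: "network \<Rightarrow> nat \<Rightarrow> (nat \<Rightarrow> real) \<Rightarrow> nat \<Rightarrow> real" where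
  "link_flow G p y l =
     (if l < links G p then min (link_demand G p l (y l)) (link_supply G p (l + 1) (y (l + 1)))
      else link_demand G p l (y l))"

definition route_density :: "network \<Rightarrow> nat \<Rightarrow> (nat \<Rightarrow> real) \<Rightarrow> bool" where
  "route_density G p y \<longleftrightarrow>
     (\<forall>l\<in>{1..links G p}. y l \<ge> 0) \<and> (\<forall>l. l \<notin> {1..links G p} \<longrightarrow> y l = 0)"

definition route_consistent :: "network \<Rightarrow> nat \<Rightarrow> real \<Rightarrow> (nat \<Rightarrow> real) \<Rightarrow> bool" where
  "route_consistent G p r y \<longleftrightarrow> (\<forall>l\<in>{1..links G p}. link_flow G p y l = inflow G p r y)"

definition routing_vector :: "network \<Rightarrow> (nat \<Rightarrow> real) \<Rightarrow> bool" where
  "routing_vector G R \<longleftrightarrow>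
     (\<forall>p\<in>{1..routes G}. R p \<ge> 0) \<and> (\<forall>p. p \<notin> {1..routes G} \<longrightarrow> R p = 0) \<and>
     (\<Sum>p=1..routes G. R p) = 1"

definition density_vector :: "network \<Rightarrow> (nat \<Rightarrow> nat \<Rightarrow> real) \<Rightarrow> bool" where
  "density_vector G x \<longleftrightarrow>
     (\<forall>p\<in>{1..routes G}. route_density G p (x p)) \<and>
     (\<forall>p. p \<notin> {1..routes G} \<longrightarrow> x p = (\<lambda>l. 0))"

definition consistent ::
    "network \<Rightarrow> real \<Rightarrow> (nat \<Rightarrow> real) \<Rightarrow> (nat \<Rightarrow> nat \<Rightarrow> real) \<Rightarrow> bool" where
  "consistent G \<Phi> R x \<longleftrightarrow> (\<forall>p\<in>{1..routes G}. route_consistent G p (\<Phi> * R p) (x p))"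

definition traffic_assignment ::
    "network \<Rightarrow> real \<Rightarrow> (nat \<Rightarrow> real) \<Rightarrow> (nat \<Rightarrow> nat \<Rightarrow> real) \<Rightarrow> bool" where
  "traffic_assignment G \<Phi> R x \<longleftrightarrow>
     routing_vector G R \<and> density_vector G x \<and> consistent G \<Phi> R x"

definition partially_transferring :: "network \<Rightarrow> real \<Rightarrow> (nat \<Rightarrow> real) \<Rightarrow> bool" where
  "partially_transferring G \<Phi> R \<longleftrightarrow> (\<exists>p\<in>{1..routes G}. \<Phi> * R p > route_capacity G p)"

definition fully_transferring :: "network \<Rightarrow> real \<Rightarrow> (nat \<Rightarrow> real) \<Rightarrow> bool" where
  "fully_transferring G \<Phi> R \<longleftrightarrow> \<not> partially_transferring G \<Phi> R"

text \<open>The first branch covers an empty link (density and flow zero). In a traffic assignment a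
  link with zero flow is always empty, so the quotient is never taken with a zero denominator; and
  both branches agree on links in free flow with positive flow.\<close>

definition link_time :: "network \<Rightarrow> nat \<Rightarrow> nat \<Rightarrow> real \<Rightarrow> real \<Rightarrow> real" where
  "link_time G p l d f =
     (if f = link_demand G p l d then link_length G p l / free_speed G p l
      else link_length G p l * d / f)"

definition route_time :: "network \<Rightarrow> nat \<Rightarrow> (nat \<Rightarrow> real) \<Rightarrow> real" where
  "route_time G p y = (\<Sum>l=1..links G p. link_time G p l (y l) (link_flow G p y l))"

definition free_time :: "network \<Rightarrow> nat \<Rightarrow> real" where
  "free_time G p = (\<Sum>l=1..links G p. link_length G p l / free_speed G p l)"

definition free_density :: "network \<Rightarrow> nat \<Rightarrow> nat \<Rightarrow> real" where
  "free_density G p l = route_capacity G p / free_speed G p l"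

definition cong_density :: "network \<Rightarrow> nat \<Rightarrow> nat \<Rightarrow> real" where
  "cong_density G p l = jam_density G p l - route_capacity G p / wave_speed G p l"

definition sat_time :: "network \<Rightarrow> nat \<Rightarrow> real" where
  "sat_time G p =
     (\<Sum>l\<in>{1..<bottleneck G p}. link_time G p l (cong_density G p l) (route_capacity G p)) +
     (\<Sum>l\<in>{bottleneck G p..links G p}. link_length G p l / free_speed G p l)"

text \<open>
  Saturated density profiles: the route carries its capacity, and the queue ahead of the
  bottleneck ends on link \<open>m\<close>. The density of link \<open>m\<close> ranges down to the free-flow density at
  flow \<^term>\<open>route_capacity G p\<close>, not only down to the critical density, since otherwise not every
  travel time between \<^term>\<open>free_time G p\<close> and \<^term>\<open>sat_time G p\<close> would be attained. If the
  bottleneck is the first link, there is no \<open>m\<close> and the only such profile is free flow.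
\<close>

definition saturated_profile :: "network \<Rightarrow> nat \<Rightarrow> (nat \<Rightarrow> real) \<Rightarrow> bool" where
  "saturated_profile G p y \<longleftrightarrow>
     (\<forall>l\<in>{bottleneck G p..links G p}. y l = free_density G p l) \<and>
     (bottleneck G p \<noteq> 1 \<longrightarrow>
       (\<exists>m\<in>{1..<bottleneck G p}.
          (\<forall>l\<in>{1..<m}. y l = free_density G p l) \<and>
          free_density G p m \<le> y m \<and> y m \<le> cong_density G p m \<and>
          (\<forall>l\<in>{m<..<bottleneck G p}. y l = cong_density G p l)))"

definition route_time_inv :: "network \<Rightarrow> nat \<Rightarrow> real \<Rightarrow> (nat \<Rightarrow> real)" where
  "route_time_inv G p t =
     (THE y. route_density G p y \<and> route_consistent G p (route_capacity G p) y \<and>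
             (\<forall>l\<in>{1..links G p}. link_flow G p y l = route_capacity G p) \<and>
             route_time G p y = t \<and> saturated_profile G p y)"

definition distinct_times :: "network \<Rightarrow> bool" where
  "distinct_times G \<longleftrightarrow>
     (\<forall>p\<in>{1..routes G}. \<forall>q\<in>{1..routes G}. p < q \<longrightarrow> free_time G p < free_time G q) \<and>
     (\<forall>p\<in>{1..routes G}. \<forall>q\<in>{1..routes G}. p \<noteq> q \<longrightarrow> sat_time G p \<noteq> sat_time G q)"

definition wardrop_equilibrium ::
    "network \<Rightarrow> real \<Rightarrow> (nat \<Rightarrow> real) \<Rightarrow> (nat \<Rightarrow> nat \<Rightarrow> real) \<Rightarrow> bool" where
  "wardrop_equilibrium G \<Phi> R x \<longleftrightarrow> traffic_assignment G \<Phi> R x \<and>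
     (\<forall>p\<in>{1..routes G}. R p > 0 \<longrightarrow>
        (\<forall>q\<in>{1..routes G}. route_time G p (x p) \<le> route_time G q (x q)))"

definition used_routes_time ::
    "network \<Rightarrow> (nat \<Rightarrow> real) \<Rightarrow> (nat \<Rightarrow> nat \<Rightarrow> real) \<Rightarrow> real \<Rightarrow> bool" where
  "used_routes_time G R x t \<longleftrightarrow>
     (\<forall>p\<in>{1..routes G}. R p > 0 \<longrightarrow> route_time G p (x p) = t)"

end

theory Submission
  imports Defs
begin

text \<open>
  On a route carrying less than its capacity every link is in free flow, because congestion below
  capacity would propagate downstream to the destination. A route carrying its capacity has a queue
  ahead of the bottleneck; the possible queues form a chain on which travel time increases strictly
  from \<^const>\<open>free_time\<close> to \<^const>\<open>sat_time\<close>, and if the offered flow exceeds the capacity the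
  queue is maximal. So in an equilibrium whose used routes have travel time \<open>t\<close>, routes with free-flow
  time below \<open>t\<close> carry at least their capacity, those with free-flow time above \<open>t\<close> are unused,
  and only a route with saturated time \<open>t\<close> can be offered more than its capacity. Comparing the total
  flow with the capacities of the first routes then determines \<open>t\<close> and the routing.
\<close>

subsection \<open>Densities and travel times on a single route\<close>

text \<open>Flow alone does not fix the state of a route: at exactly its capacity a route admits a
  whole chain of queues, so its travel time can be any value between the two extremes. This freedom
  lets fast routes slow down to match a slower one. It also limits uniqueness: if
  \<open>\<Phi>\<close> equals the total capacity of the first \<open>k\<close> routes, the common
  time may rise while the routing stays the same. An equilibrium is therefore analysed through its
  routing together with a level \<open>t\<close>, which determine all densities. One level that
  always matters is the smaller of \<open>free_time G k\<close> and the least saturated time among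
  the first \<open>k\<close> routes. At the former enough routes have opened to carry
  \<open>\<Phi>\<close>; at the latter some queue can grow no further, and that route absorbs the
  surplus. Since queues are indexed by a real filling parameter, the intermediate value theorem
  supplies a queue for each admissible time.\<close>

definition free_profile :: "network \<Rightarrow> nat \<Rightarrow> real \<Rightarrow> nat \<Rightarrow> real" where
  "free_profile G p r l = (if l \<in> {1..links G p} then r / free_speed G p l else 0)"

text \<open>The link where the queue ends is not named: if the queue stops exactly between two
  links, the densities do not determine it. The last clause instead says that a queue, once begun,
  fills every link up to the bottleneck. This form also covers a bottleneck on the first
  link.\<close>

definition queue_profile :: "network \<Rightarrow> nat \<Rightarrow> (nat \<Rightarrow> real) \<Rightarrow> bool" where
  "queue_profile G p y \<longleftrightarrow>
     (\<forall>l. l \<notin> {1..links G p} \<longrightarrow> y l = 0) \<and>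
     (\<forall>l\<in>{bottleneck G p..links G p}. y l = free_density G p l) \<and>
     (\<forall>l\<in>{1..<bottleneck G p}. free_density G p l \<le> y l \<and> y l \<le> cong_density G p l) \<and>
     (\<forall>l\<in>{1..<bottleneck G p}. \<forall>m\<in>{l<..<bottleneck G p}.
        y l \<noteq> free_density G p l \<longrightarrow> y m = cong_density G p m)"

text \<open>The queue occupying the last \<open>s\<close> links ahead of the bottleneck; a fractional part of \<open>s\<close>
  interpolates the density of the link where the queue ends.\<close>

definition queue_filling :: "network \<Rightarrow> nat \<Rightarrow> real \<Rightarrow> nat \<Rightarrow> real" where
  "queue_filling G p s l =
     (if l \<in> {1..<bottleneck G p} then
        free_density G p l + max 0 (min 1 (s + 1 + real l - real (bottleneck G p))) *
          (cong_density G p l - free_density G p l)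
      else free_profile G p (route_capacity G p) l)"

locale route =
  fixes G :: network and p :: nat
  assumes links_pos: "links G p \<ge> 1"
    and link_pos: "\<And>l. l \<in> {1..links G p} \<Longrightarrow>
      jam_density G p l > 0 \<and> capacity G p l > 0 \<and> free_speed G p l > 0 \<and>
      link_length G p l > 0 \<and> crit_density G p l < jam_density G p l"
    and unique_bottleneck:
      "\<exists>!b. b \<in> {1..links G p} \<and> capacity G p b = route_capacity G p"
begin

abbreviation "n \<equiv> links G p"
abbreviation "b \<equiv> bottleneck G p"
abbreviation "z \<equiv> route_capacity G p"
abbreviation "F \<equiv> capacity G p"
abbreviation "v \<equiv> free_speed G p"
abbreviation "w \<equiv> wave_speed G p"
abbreviation "xj \<equiv> jam_density G p"

section \<open>Demand and supply of single links\<close>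

lemma bottleneck: "b \<in> {1..n}" "F b = z"
  using theI'[OF unique_bottleneck] unfolding bottleneck_def by blast+

lemma capacity_ge: "l \<in> {1..n} \<Longrightarrow> z \<le> F l"
  by (simp add: route_capacity_def)

lemma capacity_gt: "l \<in> {1..n} \<Longrightarrow> l \<noteq> b \<Longrightarrow> z < F l"
  using ex1E[OF unique_bottleneck] bottleneck capacity_ge[of l] order_le_less by metis

lemma z_pos: "z > 0"
  using bottleneck link_pos[OF bottleneck(1)] by simp

lemma w_pos: "l \<in> {1..n} \<Longrightarrow> w l > 0"
  using link_pos by (simp add: wave_speed_def)

text \<open>\<open>wave_speed\<close> is chosen so that supply starts to fall below capacity at
  precisely the density where demand reaches it.\<close>

lemma critical_density:
  assumes "l \<in> {1..n}"
  shows "F l / v l = xj l - F l / w l"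
proof -
  have "F l / w l = xj l - crit_density G p l"
    using link_pos[OF assms] unfolding wave_speed_def by simp
  then show ?thesis
    by (simp add: crit_density_def)
qed

text \<open>Together with \<open>supply_ge_iff\<close> this turns "the link can send and receive
  \<open>g\<close>" into a density interval from \<open>g / v l\<close> to
  \<open>xj l - g / w l\<close>.\<close>

lemma demand_ge_iff:
  assumes "l \<in> {1..n}" "g \<le> F l"
  shows "g \<le> link_demand G p l d \<longleftrightarrow> g / v l \<le> d"
  using link_pos[OF assms(1)] assms(2) by (auto simp: link_demand_def field_simps)

lemma supply_ge_iff:
  assumes "l \<in> {1..n}" "g \<le> F l"
  shows "g \<le> link_supply G p l d \<longleftrightarrow> d \<le> xj l - g / w l"
  using w_pos[OF assms(1)] assms(2) by (auto simp: link_supply_def field_simps)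

lemma demand_free: "l \<in> {1..n} \<Longrightarrow> g \<le> F l \<Longrightarrow> link_demand G p l (g / v l) = g"
  using link_pos[of l] by (auto simp: link_demand_def)

lemma demand_eq_imp_free:
  "l \<in> {1..n} \<Longrightarrow> g < F l \<Longrightarrow> link_demand G p l d = g \<Longrightarrow> d = g / v l"
  using link_pos[of l] by (auto simp: link_demand_def min_def field_simps split: if_splits)

lemma supply_congested: "l \<in> {1..n} \<Longrightarrow> g \<le> F l \<Longrightarrow> link_supply G p l (xj l - g / w l) = g"
  using w_pos[of l] by (auto simp: link_supply_def)

lemma supply_eq_imp_congested:
  "l \<in> {1..n} \<Longrightarrow> g < F l \<Longrightarrow> link_supply G p l d = g \<Longrightarrow> d = xj l - g / w l"
  using w_pos[of l] by (auto simp: link_supply_def min_def field_simps split: if_splits)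

lemma demand_le: "link_demand G p l d \<le> F l"
  by (simp add: link_demand_def)

lemma supply_le: "link_supply G p l d \<le> F l"
  by (simp add: link_supply_def)

lemma demand_of_congested:
  assumes "l \<in> {1..n}" "g < F l"
  shows "link_demand G p l (xj l - g / w l) = F l"
proof -
  have "g / w l < F l / w l"
    using assms w_pos by (simp add: divide_strict_right_mono)
  then have "F l / v l \<le> xj l - g / w l"
    using critical_density[OF assms(1)] by simp
  then show ?thesis
    using demand_ge_iff[OF assms(1), of "F l"] demand_le[of l] by (meson order.refl order.antisym)
qed

lemma supply_of_free:
  assumes "l \<in> {1..n}" "g \<le> F l"
  shows "link_supply G p l (g / v l) = F l"
proof -
  have "g / v l \<le> F l / v l"
    using assms link_pos[OF assms(1)] by (simp add: divide_right_mono)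
  then show ?thesis
    using critical_density[OF assms(1)] supply_ge_iff[OF assms(1), of "F l"] supply_le[of l]
    by (metis order.refl order.antisym)
qed

text \<open>Away from the bottleneck the flow \<open>z\<close> is below capacity, so the two
  densities lie on either side of the critical one; at the bottleneck both coincide with it.\<close>

lemma free_less_congested:
  assumes "l \<in> {1..n}" "l \<noteq> b"
  shows "free_density G p l < cong_density G p l"
proof -
  have "z / v l < F l / v l" "z / w l < F l / w l"
    using assms link_pos w_pos capacity_gt by (auto simp: divide_strict_right_mono)
  then show ?thesis
    using critical_density[OF assms(1)] by (simp add: free_density_def cong_density_def)
qed

text \<open>A congested link below capacity forces the next link to be congested as well, which is
  impossible at the destination.\<close>

lemma free_flow_downstream:
  assumes flow: "\<forall>l\<in>{1..n}. link_flow G p y l = g"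
    and l: "1 \<le> l" "l \<le> n" and below: "\<forall>i\<in>{l..n}. g < F i"
  shows "y l = g / v l"
proof -
  have "link_demand G p l (y l) = g"
    using l(2)
  proof (rule inc_induct)
    show "link_demand G p n (y n) = g"
      using flow links_pos by (auto simp: link_flow_def)
  next
    fix i assume i: "l \<le> i" "i < n" and IH: "link_demand G p (Suc i) (y (Suc i)) = g"
    have "min (link_demand G p i (y i)) (link_supply G p (Suc i) (y (Suc i))) = g"
      using flow i l by (auto simp: link_flow_def)
    moreover have "link_supply G p (Suc i) (y (Suc i)) \<noteq> g"
    proof
      assume *: "link_supply G p (Suc i) (y (Suc i)) = g"
      have lt: "g < F (Suc i)" and mem: "Suc i \<in> {1..n}"
        using below i by auto
      show False
        using supply_eq_imp_congested[OF mem lt *] demand_of_congested[OF mem lt] IH lt by simp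
    qed
    ultimately show "link_demand G p i (y i) = g"
      by (auto simp: min_def split: if_splits)
  qed
  then show ?thesis
    using demand_eq_imp_free l below by auto
qed

section \<open>Flow through a route, and densities below capacity\<close>

lemma flow_le_capacity:
  assumes "l \<in> {1..n}"
  shows "link_flow G p y l \<le> F l"
  using demand_le[of l "y l"] by (auto simp: link_flow_def)

text \<open>If the flow were below both the offer and the capacity, the supply of link 1 would be
  the binding term. But all links would then be in free flow, where link 1 supplies its full
  capacity, which is more than the flow.\<close>

lemma consistent_flow:
  assumes "route_consistent G p r y"
  shows "inflow G p r y = min r z"
proof -
  define g where "g = inflow G p r y"
  have flow: "\<forall>l\<in>{1..n}. link_flow G p y l = g"
    using assms by (simp add: route_consistent_def g_def)
  have le: "g \<le> r" "g \<le> z"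
    using flow flow_le_capacity[of b y] bottleneck by (auto simp: g_def inflow_def)
  have "False" if lt: "g < r" "g < z"
  proof -
    have below: "\<forall>i\<in>{1..n}. g < F i"
      using lt capacity_ge by force
    have one: "1 \<in> {1..n}"
      using links_pos by simp
    have s: "link_supply G p 1 (y 1) = g"
      using lt by (auto simp: g_def inflow_def min_def split: if_splits)
    have "y 1 = g / v 1"
      using free_flow_downstream[OF flow _ _ below] links_pos by simp
    then have "link_supply G p 1 (y 1) = F 1"
      using supply_of_free[OF one, of g] below one by (simp add: less_imp_le)
    with s have "F 1 = g"
      by simp
    with bspec[OF below one] show False
      by simp
  qed
  with le show ?thesis
    by (fastforce simp: g_def min_def)
qed

lemma below_capacity_density:
  assumes y: "route_density G p y" "route_consistent G p r y" and r: "r < z"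
  shows "y = free_profile G p r"
proof
  fix l
  have flow: "\<forall>l\<in>{1..n}. link_flow G p y l = r"
    using y(2) consistent_flow[OF y(2)] r by (simp add: route_consistent_def)
  have "\<forall>i\<in>{1..n}. r < F i"
    using r capacity_ge by force
  then show "y l = free_profile G p r l"
    using free_flow_downstream[OF flow, of l] y(1) by (auto simp: free_profile_def route_density_def)
qed

lemma free_profile_consistent:
  assumes r: "0 \<le> r" "r \<le> z"
  shows "route_density G p (free_profile G p r)"
    and "route_consistent G p r (free_profile G p r)"
    and "route_time G p (free_profile G p r) = free_time G p"
proof -
  show "route_density G p (free_profile G p r)"
    using link_pos r by (auto simp: route_density_def free_profile_def less_imp_le)
  have le: "r \<le> F l" if "l \<in> {1..n}" for l
    using capacity_ge[OF that] r by simp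
  have d: "link_demand G p l (free_profile G p r l) = r" if "l \<in> {1..n}" for l
    using demand_free[OF that le[OF that]] that by (auto simp: free_profile_def)
  have s: "link_supply G p l (free_profile G p r l) \<ge> r" if "l \<in> {1..n}" for l
    using supply_of_free[OF that le[OF that]] that le[OF that] by (auto simp: free_profile_def)
  have flow: "link_flow G p (free_profile G p r) l = r" if "l \<in> {1..n}" for l
    using d[OF that] s[of "l + 1"] that by (auto simp: link_flow_def)
  have "inflow G p r (free_profile G p r) = r"
    using s[of 1] links_pos by (auto simp: inflow_def)
  with flow show "route_consistent G p r (free_profile G p r)"
    by (simp add: route_consistent_def)
  show "route_time G p (free_profile G p r) = free_time G p"
    unfolding route_time_def free_time_def
    by (rule sum.cong) (auto simp: link_time_def flow d)
qed

section \<open>Queue profiles and the flow they carry\<close>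

lemma queue_profileD:
  assumes "queue_profile G p y"
  shows "l \<notin> {1..n} \<Longrightarrow> y l = 0"
    and "l \<in> {b..n} \<Longrightarrow> y l = free_density G p l"
    and "l \<in> {1..<b} \<Longrightarrow> free_density G p l \<le> y l"
    and "l \<in> {1..<b} \<Longrightarrow> y l \<le> cong_density G p l"
    and "l \<in> {1..<b} \<Longrightarrow> l < m \<Longrightarrow> m < b \<Longrightarrow> y l \<noteq> free_density G p l \<Longrightarrow> y m = cong_density G p m"
  using assms unfolding queue_profile_def by (blast, blast, blast, blast, force)

lemma links_cases:
  assumes "l \<in> {1..n}"
  obtains "l \<in> {1..<b}" | "l \<in> {b..n}"
  using assms by (cases "l < b") auto

lemma saturated_iff_queue_profile:
  assumes y: "route_density G p y"
  shows "saturated_profile G p y \<longleftrightarrow> queue_profile G p y"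
proof
  assume sat: "saturated_profile G p y"
  show "queue_profile G p y"
  proof (cases "b = 1")
    case True
    then show ?thesis
      using sat y by (auto simp: queue_profile_def saturated_profile_def route_density_def)
  next
    case False
    then obtain m where m: "m \<in> {1..<b}" "\<forall>l\<in>{1..<m}. y l = free_density G p l"
      "free_density G p m \<le> y m" "y m \<le> cong_density G p m"
      "\<forall>l\<in>{m<..<b}. y l = cong_density G p l"
      using sat unfolding saturated_profile_def by blast
    have le: "free_density G p l \<le> cong_density G p l" if "l \<in> {1..<b}" for l
      using free_less_congested[of l] bottleneck that by simp
    have "free_density G p l \<le> y l \<and> y l \<le> cong_density G p l" if "l \<in> {1..<b}" for l
      using m le[OF that] that by (cases l m rule: linorder_cases) auto
    moreover have "y i = cong_density G p i"
      if "l \<in> {1..<b}" "i \<in> {l<..<b}" "y l \<noteq> free_density G p l" for l i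
      using m that by (cases l m rule: linorder_cases) auto
    ultimately show ?thesis
      using sat y by (auto simp: queue_profile_def saturated_profile_def route_density_def)
  qed
next
  assume q: "queue_profile G p y"
  have "\<exists>m\<in>{1..<b}. (\<forall>l\<in>{1..<m}. y l = free_density G p l) \<and>
          free_density G p m \<le> y m \<and> y m \<le> cong_density G p m \<and>
          (\<forall>l\<in>{m<..<b}. y l = cong_density G p l)" if "b \<noteq> 1"
  proof (cases "\<exists>l. l \<in> {1..<b} \<and> y l \<noteq> free_density G p l")
    case True
    \<comment> \<open>The queue ends on the first link whose density differs from free flow.\<close>
    define m where "m = (LEAST l. l \<in> {1..<b} \<and> y l \<noteq> free_density G p l)"
    have m: "m \<in> {1..<b}" "y m \<noteq> free_density G p m"
      using LeastI_ex[OF True] by (auto simp: m_def)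
    have "y l = free_density G p l" if "l \<in> {1..<m}" for l
      using not_less_Least[of l "\<lambda>l. l \<in> {1..<b} \<and> y l \<noteq> free_density G p l"] that m
      by (auto simp: m_def)
    with m queue_profileD[OF q] show ?thesis
      by (intro bexI[of _ m]) auto
  next
    case False
    \<comment> \<open>Without a queue, the last link ahead of the bottleneck serves as its end: no
      link lies strictly between it and the bottleneck.\<close>
    have "b - 1 \<in> {1..<b}"
      using bottleneck that by auto
    with False queue_profileD[OF q] show ?thesis
      by (intro bexI[of _ "b - 1"]) auto
  qed
  with queue_profileD(2)[OF q] show "saturated_profile G p y"
    by (simp add: saturated_profile_def)
qed

lemma queue_profile_density:
  assumes q: "queue_profile G p y"
  shows "route_density G p y"
proof -
  have "0 \<le> y l" if l: "l \<in> {1..n}" for l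
  proof -
    have "0 \<le> free_density G p l"
      using z_pos link_pos[OF l] by (simp add: free_density_def)
    with l show ?thesis
      by (elim links_cases) (use queue_profileD(2,3)[OF q] in force)+
  qed
  with queue_profileD(1)[OF q] show ?thesis
    by (simp add: route_density_def)
qed

lemma queue_profile_demand:
  assumes q: "queue_profile G p y" and l: "l \<in> {1..n}"
  shows "z \<le> link_demand G p l (y l)"
  using l queue_profileD(2,3)[OF q, of l] demand_ge_iff[OF l capacity_ge[OF l]]
  by (elim links_cases) (auto simp: free_density_def)

lemma queue_profile_supply:
  assumes q: "queue_profile G p y" and l: "l \<in> {1..n}"
  shows "z \<le> link_supply G p l (y l)"
  using l
proof (cases rule: links_cases)
  case 1
  then show ?thesis
    using queue_profileD(4)[OF q] supply_ge_iff[OF l capacity_ge[OF l]]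
    by (auto simp: cong_density_def)
next
  case 2
  then show ?thesis
    using queue_profileD(2)[OF q 2] supply_of_free[OF l capacity_ge[OF l]] capacity_ge[OF l]
    by (auto simp: free_density_def)
qed

lemma queue_profile_supply_eq:
  assumes q: "queue_profile G p y" and l: "l \<in> {1..n}" and "l = b \<or> y l = cong_density G p l"
  shows "link_supply G p l (y l) = z"
  using assms(3)
proof
  assume "l = b"
  then show ?thesis
    using queue_profile_supply[OF q l] supply_le[of l "y l"] bottleneck by simp
next
  assume "y l = cong_density G p l"
  then show ?thesis
    using supply_congested[OF l capacity_ge[OF l]] by (simp add: cong_density_def)
qed

text \<open>On a link at free density the demand \<open>z\<close> binds. On a queued link the next
  one is congested or is the bottleneck, and its supply \<open>z\<close> binds.\<close>

lemma queue_profile_flow: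
  assumes q: "queue_profile G p y" and l: "l \<in> {1..n}"
  shows "link_flow G p y l = z"
proof (cases "y l = free_density G p l")
  case True
  then have "link_demand G p l (y l) = z"
    using demand_free[OF l capacity_ge[OF l]] by (simp add: free_density_def)
  then show ?thesis
    using queue_profile_supply[OF q, of "l + 1"] l by (auto simp: link_flow_def)
next
  case False
  then have l': "l \<in> {1..<b}"
    using queue_profileD(2)[OF q, of l] l by fastforce
  have "link_supply G p (l + 1) (y (l + 1)) = z"
  proof (rule queue_profile_supply_eq[OF q])
    show "l + 1 \<in> {1..n}"
      using l' bottleneck by auto
    show "l + 1 = b \<or> y (l + 1) = cong_density G p (l + 1)"
      using queue_profileD(5)[OF q l' _ _ False, of "l + 1"] l' by fastforce
  qed
  then show ?thesis
    using queue_profile_demand[OF q l] l' bottleneck by (auto simp: link_flow_def)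
qed

text \<open>An offer above capacity has to be cut down to \<open>z\<close> by the supply of link 1.
  This requires link 1 to be the bottleneck or congested, hence the condition
  \<open>over\<close>.\<close>

lemma queue_profile_consistent:
  assumes q: "queue_profile G p y" and r: "z \<le> r"
    and over: "z < r \<Longrightarrow> 1 < b \<Longrightarrow> y 1 = cong_density G p 1"
  shows "route_consistent G p r y"
proof -
  have one: "1 \<in> {1..n}"
    using links_pos by simp
  have "inflow G p r y = z"
  proof (cases "z < r")
    case True
    have "1 = b \<or> y 1 = cong_density G p 1"
      using over[OF True] bottleneck by fastforce
    then have "link_supply G p 1 (y 1) = z"
      by (rule queue_profile_supply_eq[OF q one])
    with True show ?thesis
      by (simp add: inflow_def)
  next
    case False
    then show ?thesis
      using r queue_profile_supply[OF q one] by (simp add: inflow_def)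
  qed
  then show ?thesis
    using queue_profile_flow[OF q] by (simp add: route_consistent_def)
qed

section \<open>Travel time along the chain of queues\<close>

lemma link_time_queue:
  assumes l: "l \<in> {1..n}" and d: "l = b \<Longrightarrow> d = free_density G p l"
  shows "link_time G p l d z = link_length G p l * d / z"
proof (cases "z = link_demand G p l d")
  case True
  \<comment> \<open>Away from the bottleneck, demand \<open>z\<close> lies below capacity and so
    identifies the density. At the bottleneck every density from the critical one upwards has demand
    \<open>z\<close>, so there the density is assumed.\<close>
  have "d = free_density G p l"
    using d demand_eq_imp_free[OF l capacity_gt[OF l] True[symmetric]]
    by (auto simp: free_density_def)
  then have "link_length G p l * d / z = link_length G p l / v l"
    using z_pos by (simp add: free_density_def)
  then show ?thesis
    using True by (simp add: link_time_def)
qed (simp add: link_time_def)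

lemma queue_profile_time:
  assumes q: "queue_profile G p y"
  shows "route_time G p y = (\<Sum>l=1..n. link_length G p l * y l / z)"
  unfolding route_time_def
  using queue_profileD(2)[OF q] bottleneck
  by (intro sum.cong) (simp_all add: queue_profile_flow[OF q] link_time_queue)

text \<open>Suppose \<open>y\<close> is larger on one link and \<open>y'\<close> on another. The
  profile that is larger on the upstream one of the two has a queue there, hence is congested on the
  downstream one, where the other cannot exceed it.\<close>

lemma queue_profile_chain:
  assumes q: "queue_profile G p y" "queue_profile G p y'"
  shows "(\<forall>l. y l \<le> y' l) \<or> (\<forall>l. y' l \<le> y l)"
proof (rule ccontr)
  assume "\<not> ?thesis"
  then obtain l m where lm: "y' l < y l" "y m < y' m"
    by (auto simp: not_le)
  have l: "l \<in> {1..<b}" if "y' l \<noteq> y l" for l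
    using that queue_profileD(1,2)[OF q(1), of l] queue_profileD(1,2)[OF q(2), of l] by force
  have "l \<in> {1..<b}" "m \<in> {1..<b}"
    using l lm by auto
  then show False
    using lm queue_profileD(3-5)[OF q(1)] queue_profileD(3-5)[OF q(2)]
    by (cases l m rule: linorder_cases) (smt (verit) atLeastLessThan_iff)+
qed

text \<open>The two profiles are comparable, and on comparable profiles the time is a sum of
  densities with positive weights, hence strictly monotone.\<close>

lemma queue_profile_unique:
  assumes q: "queue_profile G p y" "queue_profile G p y'"
    and t: "route_time G p y = route_time G p y'"
  shows "y = y'"
proof -
  have eq: "y = y'" if q: "queue_profile G p y" "queue_profile G p y'"
    and t: "route_time G p y = route_time G p y'" and le: "\<forall>l. y l \<le> y' l" for y y'
  proof (rule ccontr)
    assume "y \<noteq> y'"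
    then obtain l where "y l \<noteq> y' l"
      by auto
    then have l: "y l < y' l" "l \<in> {1..n}"
      using spec[OF le, of l] queue_profileD(1)[OF q(1), of l] queue_profileD(1)[OF q(2), of l]
      by force+
    have "(\<Sum>l=1..n. link_length G p l * y l / z) < (\<Sum>l=1..n. link_length G p l * y' l / z)"
    proof (rule sum_strict_mono_ex1)
      show "\<forall>i\<in>{1..n}. link_length G p i * y i / z \<le> link_length G p i * y' i / z"
        using link_pos z_pos le by (meson divide_right_mono less_imp_le mult_left_mono)
      show "\<exists>i\<in>{1..n}. link_length G p i * y i / z < link_length G p i * y' i / z"
        using link_pos z_pos l by (meson divide_strict_right_mono mult_strict_left_mono)
    qed simp
    with t show False
      by (simp add: queue_profile_time q)
  qed
  show ?thesis
    using queue_profile_chain[OF q] eq[OF q t] eq[OF q(2,1) t[symmetric]] by auto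
qed

lemma queue_filling_profile: "queue_profile G p (queue_filling G p s)"
  unfolding queue_profile_def
proof (intro conjI ballI allI impI)
  fix l
  show "queue_filling G p s l = 0" if "l \<notin> {1..n}"
    using that bottleneck by (auto simp: queue_filling_def free_profile_def)
  show "queue_filling G p s l = free_density G p l" if "l \<in> {b..n}"
    using that bottleneck by (auto simp: queue_filling_def free_profile_def free_density_def)
  assume l: "l \<in> {1..<b}"
  have lt: "free_density G p l < cong_density G p l" if "l \<in> {1..<b}" for l
    using free_less_congested[of l] that bottleneck by simp
  show "free_density G p l \<le> queue_filling G p s l"
    using l lt[OF l] by (simp add: queue_filling_def)
  have "c * (cong_density G p l - free_density G p l) \<le> cong_density G p l - free_density G p l"
    if "c \<le> 1" for c
    using that lt[OF l] by (simp add: mult_left_le_one_le mult_le_cancel_right1)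
  from this[of "max 0 (min 1 (s + 1 + real l - real b))"]
  show "queue_filling G p s l \<le> cong_density G p l"
    using l by (simp add: queue_filling_def)
  fix m assume m: "m \<in> {l<..<b}" and "queue_filling G p s l \<noteq> free_density G p l"
  \<comment> \<open>The unclamped fill \<open>s + 1 + l - b\<close> grows by one per link, so a
    positive fill on \<open>l\<close> is at least one on every later link.\<close>
  then have "s + 1 + real l - real b > 0"
    using l by (auto simp: queue_filling_def max_def min_def split: if_splits)
  then have "s + 1 + real m - real b \<ge> 1"
    using m by auto
  then show "queue_filling G p s m = cong_density G p m"
    using m l by (auto simp: queue_filling_def)
qed

lemma queue_filling_empty: "queue_filling G p 0 = free_profile G p z"
  using bottleneck
  by (auto simp: queue_filling_def free_profile_def free_density_def fun_eq_iff max_def min_def)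

text \<open>Link \<open>l\<close> is full from \<open>s = b - l\<close> on, so \<open>s = b\<close>
  suffices for all links, including link 1, without subtracting on naturals.\<close>

lemma queue_filling_full: "l \<in> {1..<b} \<Longrightarrow> queue_filling G p (real b) l = cong_density G p l"
  by (auto simp: queue_filling_def)

lemma free_time_eq: "route_time G p (free_profile G p z) = free_time G p"
  using free_profile_consistent(3) z_pos by simp

lemma route_time_congested:
  assumes q: "queue_profile G p y" and y: "\<forall>l\<in>{1..<b}. y l = cong_density G p l"
  shows "route_time G p y = sat_time G p"
proof -
  have "{1..n} = {1..<b} \<union> {b..n}" and disj: "{1..<b} \<inter> {b..n} = {}"
    using bottleneck by auto
  then have "route_time G p y =
      (\<Sum>l\<in>{1..<b}. link_length G p l * y l / z) + (\<Sum>l\<in>{b..n}. link_length G p l * y l / z)"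
    by (simp add: queue_profile_time[OF q] sum.union_disjoint)
  moreover have "(\<Sum>l\<in>{1..<b}. link_length G p l * y l / z) =
      (\<Sum>l\<in>{1..<b}. link_time G p l (cong_density G p l) z)"
    using y bottleneck by (intro sum.cong) (simp_all add: link_time_queue)
  moreover have "(\<Sum>l\<in>{b..n}. link_length G p l * y l / z) =
      (\<Sum>l\<in>{b..n}. link_length G p l / v l)"
    using queue_profileD(2)[OF q] z_pos
    by (intro sum.cong) (simp_all add: free_density_def)
  ultimately show ?thesis
    by (simp add: sat_time_def)
qed

lemma sat_time_eq: "route_time G p (queue_filling G p (real b)) = sat_time G p"
  using route_time_congested queue_filling_profile queue_filling_full by blast

lemma queue_profile_time_mono:
  assumes "queue_profile G p y" "queue_profile G p y'" "\<And>l. l \<in> {1..n} \<Longrightarrow> y l \<le> y' l"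
  shows "route_time G p y \<le> route_time G p y'"
  unfolding queue_profile_time[OF assms(1)] queue_profile_time[OF assms(2)]
proof (rule sum_mono)
  fix l assume l: "l \<in> {1..n}"
  show "link_length G p l * y l / z \<le> link_length G p l * y' l / z"
    using link_pos[OF l] z_pos assms(3)[OF l] by (simp add: divide_right_mono)
qed

lemma free_profile_queue: "queue_profile G p (free_profile G p z)"
  using queue_filling_profile[of 0] queue_filling_empty by simp

text \<open>The empty and the full queue are the least and greatest elements of the chain.\<close>

lemma queue_profile_time_bounds:
  assumes q: "queue_profile G p y"
  shows "free_time G p \<le> route_time G p y" "route_time G p y \<le> sat_time G p"
proof -
  have "free_profile G p z l \<le> y l" if "l \<in> {1..n}" for l
    using that
  proof (cases rule: links_cases)
    case 1
    then show ?thesis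
      using queue_profileD(3)[OF q 1] that by (simp add: free_profile_def free_density_def)
  next
    case 2
    then show ?thesis
      using queue_profileD(2)[OF q 2] queue_profileD(2)[OF free_profile_queue 2] by simp
  qed
  then show "free_time G p \<le> route_time G p y"
    using queue_profile_time_mono[OF free_profile_queue q] by (simp add: free_time_eq)
  have "y l \<le> queue_filling G p (real b) l" if "l \<in> {1..n}" for l
    using that
  proof (cases rule: links_cases)
    case 1
    then show ?thesis
      using queue_profileD(4)[OF q 1] by (simp add: queue_filling_full)
  next
    case 2
    then show ?thesis
      using queue_profileD(2)[OF q 2] queue_profileD(2)[OF queue_filling_profile 2] by simp
  qed
  then show "route_time G p y \<le> sat_time G p"
    using queue_profile_time_mono[OF q queue_filling_profile] by (simp add: sat_time_eq[symmetric])
qed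

lemma free_time_le_sat_time: "free_time G p \<le> sat_time G p"
  using queue_profile_time_bounds[OF free_profile_queue] by simp

text \<open>A link ahead of the bottleneck makes the empty and full queues distinct, and distinct
  queue profiles have distinct times.\<close>

lemma free_time_less_sat_time:
  assumes "b \<noteq> 1"
  shows "free_time G p < sat_time G p"
proof -
  have one: "1 \<in> {1..<b}"
    using assms bottleneck by auto
  then have "free_profile G p z 1 \<noteq> queue_filling G p (real b) 1"
    using free_less_congested[of 1] bottleneck
    by (simp add: queue_filling_full free_profile_def free_density_def)
  then have "free_time G p \<noteq> sat_time G p"
    using queue_profile_unique[OF free_profile_queue queue_filling_profile, of "real b"]
    by (metis free_time_eq sat_time_eq)
  then show ?thesis
    using free_time_le_sat_time by simp
qed

text \<open>Each density of \<open>queue_filling\<close> is continuous in \<open>s\<close>, and so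
  is the travel time; it runs from the free-flow time at \<open>s = 0\<close> to the saturated time
  at \<open>s = b\<close>.\<close>

lemma queue_profile_exists:
  assumes t: "free_time G p \<le> t" "t \<le> sat_time G p"
  shows "\<exists>y. queue_profile G p y \<and> route_time G p y = t"
proof -
  let ?T = "\<lambda>s. \<Sum>l=1..n. link_length G p l * queue_filling G p s l / z"
  have T: "?T s = route_time G p (queue_filling G p s)" for s
    using queue_profile_time[OF queue_filling_profile] by simp
  have "continuous_on {0..real b} (\<lambda>s. queue_filling G p s l)" for l
    by (cases "l \<in> {1..<b}") (auto simp: queue_filling_def intro!: continuous_intros)
  then have "continuous_on {0..real b} ?T"
    using z_pos by (intro continuous_intros) auto
  moreover have "?T 0 \<le> t" "t \<le> ?T (real b)"
    unfolding T using t by (simp_all add: queue_filling_empty free_time_eq sat_time_eq)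
  ultimately obtain s where "?T s = t"
    using IVT'[of ?T 0 t "real b"] by auto
  then show ?thesis
    using T queue_filling_profile by metis
qed

section \<open>Inverse travel time and classification of route states\<close>

lemma route_time_inv_eq:
  assumes q: "queue_profile G p y"
  shows "route_time_inv G p (route_time G p y) = y"
  unfolding route_time_inv_def
proof (rule the_equality)
  show "route_density G p y \<and> route_consistent G p z y \<and> (\<forall>l\<in>{1..n}. link_flow G p y l = z) \<and>
      route_time G p y = route_time G p y \<and> saturated_profile G p y"
    using queue_profile_density[OF q] queue_profile_consistent[OF q] queue_profile_flow[OF q]
      saturated_iff_queue_profile q by auto
qed (use q queue_profile_unique saturated_iff_queue_profile in blast)

lemma route_time_inv_profile:
  assumes "free_time G p \<le> t" "t \<le> sat_time G p"
  shows "queue_profile G p (route_time_inv G p t)" "route_time G p (route_time_inv G p t) = t"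
  using queue_profile_exists[OF assms] route_time_inv_eq by auto

text \<open>Every link sends and receives \<open>z\<close>, which confines its density between the
  free and the congested value. A link that is not free wants to send more than \<open>z\<close>, so
  its successor must be holding it back; congestion thus spreads up to the bottleneck.\<close>

lemma at_capacity_profile:
  assumes y: "route_density G p y" "route_consistent G p r y" and r: "z \<le> r"
  shows "queue_profile G p y" "z < r \<Longrightarrow> route_time G p y = sat_time G p"
proof -
  have inflow: "inflow G p r y = z"
    using consistent_flow[OF y(2)] r by simp
  with y(2) have flow: "\<forall>l\<in>{1..n}. link_flow G p y l = z"
    by (simp add: route_consistent_def)
  have supply_ge: "z \<le> link_supply G p l (y l)" if l: "l \<in> {1..n}" for l
  proof (cases "l = 1")
    case True
    then show ?thesis
      using inflow by (auto simp: inflow_def)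
  next
    case False
    with l obtain i where i: "l = Suc i" "i \<in> {1..n}" "i < n"
      by (cases l) auto
    then show ?thesis
      using bspec[OF flow i(2)] by (simp add: link_flow_def)
  qed
  have demand_ge: "z \<le> link_demand G p l (y l)" if l: "l \<in> {1..n}" for l
    using bspec[OF flow l] by (auto simp: link_flow_def split: if_splits)
  have after: "y l = free_density G p l" if l: "l \<in> {b<..n}" for l
    using free_flow_downstream[OF flow, of l] l bottleneck capacity_gt
    by (auto simp: free_density_def)
  \<comment> \<open>At the bottleneck the lower and the upper density bound are both the critical
    density.\<close>
  have "y b \<le> xj b - z / w b" "z / v b \<le> y b"
    using supply_ge[OF bottleneck(1)] demand_ge[OF bottleneck(1)] bottleneck
      supply_ge_iff[OF bottleneck(1), of z] demand_ge_iff[OF bottleneck(1), of z] by auto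
  then have "y b = free_density G p b"
    using critical_density[OF bottleneck(1)] bottleneck by (simp add: free_density_def)
  with after have from_b: "y l = free_density G p l" if "l \<in> {b..n}" for l
    using that by (cases "l = b") auto
  have bounds: "free_density G p l \<le> y l" "y l \<le> cong_density G p l" if "l \<in> {1..n}" for l
    using demand_ge[OF that] supply_ge[OF that] demand_ge_iff[OF that capacity_ge[OF that]]
      supply_ge_iff[OF that capacity_ge[OF that]]
    by (simp_all add: free_density_def cong_density_def)
  have next_link: "y (Suc l) = cong_density G p (Suc l)"
    if l: "l \<in> {1..n}" "Suc l < b" and ne: "y l \<noteq> free_density G p l" for l
  proof -
    have mem: "Suc l \<in> {1..n}" and lt: "z < F l" "z < F (Suc l)"
      using l bottleneck capacity_gt by auto
    have "link_demand G p l (y l) \<noteq> z"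
      using demand_eq_imp_free[OF l(1) lt(1)] ne by (auto simp: free_density_def)
    then have "link_supply G p (Suc l) (y (Suc l)) = z"
      using bspec[OF flow l(1)] mem by (auto simp: link_flow_def min_def split: if_splits)
    then show ?thesis
      using supply_eq_imp_congested[OF mem lt(2)] by (simp add: cong_density_def)
  qed
  \<comment> \<open>Congested differs from free ahead of the bottleneck, so the step from one link
    to the next can be iterated.\<close>
  have cong_ne: "cong_density G p l \<noteq> free_density G p l" if "1 \<le> l" "l < b" for l
    using free_less_congested[of l] that bottleneck by fastforce
  have spread: "y m = cong_density G p m"
    if l: "1 \<le> l" "l < m" "m < b" "y l \<noteq> free_density G p l" for l m
    using Suc_leI[OF l(2)] l(3)
  proof (induction m rule: dec_induct)
    case base
    then show ?case
      using next_link[of l] l bottleneck by simp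
  next
    case (step m)
    then show ?case
      using cong_ne[of m] next_link[of m] l bottleneck
      by auto
  qed
  show q: "queue_profile G p y"
    using y(1) from_b bounds spread bottleneck by (auto simp: queue_profile_def route_density_def)
  assume over: "z < r"
  have "y l = cong_density G p l" if l: "l \<in> {1..<b}" for l
  proof -
    have one: "1 \<in> {1..n}" "1 < b"
      using links_pos l by auto
    \<comment> \<open>The surplus is refused at the entrance, so the supply of link 1 equals
      \<open>z\<close> and the queue reaches back to the origin.\<close>
    have "y 1 = cong_density G p 1"
      using inflow over supply_eq_imp_congested[OF one(1) capacity_gt[OF one(1)]] one(2)
      by (auto simp: inflow_def cong_density_def min_def split: if_splits)
    then show ?thesis
      using spread[of 1 l] cong_ne[of 1] l one(2) by (cases "l = 1") auto
  qed
  then show "route_time G p y = sat_time G p"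
    using route_time_congested[OF q] by blast
qed

lemma route_time_inv_consistent:
  assumes t: "free_time G p \<le> t" "t \<le> sat_time G p" and r: "z \<le> r" and "z < r \<Longrightarrow> t = sat_time G p"
  shows "route_consistent G p r (route_time_inv G p t)"
proof (rule queue_profile_consistent[OF _ r])
  show "queue_profile G p (route_time_inv G p t)"
    using route_time_inv_profile[OF t] by blast
  assume "z < r" "1 < b"
  then have "route_time_inv G p t = queue_filling G p (real b)"
    using assms(4) route_time_inv_eq[OF queue_filling_profile[of "real b"]] by (simp add: sat_time_eq)
  with \<open>1 < b\<close> show "route_time_inv G p t 1 = cong_density G p 1"
    using queue_filling_full by simp
qed

text \<open>Flow below capacity fixes the time from below, an offer above capacity fixes it from
  above; an offer equal to capacity leaves the time open.\<close>

lemma route_state: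
  assumes y: "route_density G p y" "route_consistent G p r y" and r: "0 \<le> r"
  shows "r < z \<Longrightarrow> y = free_profile G p r \<and> route_time G p y = free_time G p"
    and "z \<le> r \<Longrightarrow> free_time G p \<le> route_time G p y \<and> route_time G p y \<le> sat_time G p \<and>
           y = route_time_inv G p (route_time G p y)"
    and "z < r \<Longrightarrow> route_time G p y = sat_time G p"
  using below_capacity_density[OF y] free_profile_consistent(3)[OF r]
    at_capacity_profile[OF y] queue_profile_time_bounds[of y] route_time_inv_eq[of y] by auto

lemma route_time_inv_free: "route_time_inv G p (free_time G p) = free_profile G p z"
  using route_time_inv_eq[OF free_profile_queue] free_time_eq by simp

end

subsection \<open>Wardrop equilibria on a parallel network\<close>

lemma sum_upto_last:
  fixes f :: "nat \<Rightarrow> real"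
  assumes "1 \<le> m"
  shows "(\<Sum>p=1..m. f p) = f m + (\<Sum>p\<in>{1..<m}. f p)"
proof -
  have "{1..m} = insert m {1..<m}"
    using assms by auto
  then show ?thesis
    by (simp only: sum.insert finite_atLeastLessThan atLeastLessThan_iff less_irrefl simp_thms)
qed

locale routing_game =
  fixes G :: network and \<Phi> :: real
  assumes net: "parallel_network G" and Phi: "\<Phi> > 0" and A1: "unique_bottlenecks G"
begin

abbreviation "N \<equiv> routes G"
abbreviation "cap \<equiv> route_capacity G"

lemma route: "p \<in> {1..N} \<Longrightarrow> route G p"
  using net A1 by unfold_locales (auto simp: parallel_network_def unique_bottlenecks_def)

text \<open>\<open>Q\<close> collects the routes that receive a queue tuned to time
  \<open>t\<close>; all others run in free flow and must not be faster than \<open>t\<close>. The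
  vector \<open>\<phi>\<close> holds absolute flows, so the routing is
  \<open>\<phi> / \<Phi>\<close>.\<close>

lemma wardrop_equilibriumI:
  assumes nonneg: "\<And>p. p \<in> {1..N} \<Longrightarrow> 0 \<le> \<phi> p" and total: "(\<Sum>p=1..N. \<phi> p) = \<Phi>"
    and queued: "\<And>p. p \<in> {1..N} \<Longrightarrow> p \<in> Q \<Longrightarrow>
      cap p \<le> \<phi> p \<and> free_time G p \<le> t \<and> t \<le> sat_time G p \<and> (cap p < \<phi> p \<longrightarrow> t = sat_time G p)"
    and free: "\<And>p. p \<in> {1..N} \<Longrightarrow> p \<notin> Q \<Longrightarrow>
      \<phi> p \<le> cap p \<and> t \<le> free_time G p \<and> (0 < \<phi> p \<longrightarrow> free_time G p = t)"
  obtains R x where "wardrop_equilibrium G \<Phi> R x" "used_routes_time G R x t"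
    "\<And>p. p \<in> {1..N} \<Longrightarrow> \<Phi> * R p = \<phi> p"
    "\<And>p. p \<in> {1..N} \<Longrightarrow> p \<in> Q \<Longrightarrow> x p = route_time_inv G p t"
    "\<And>p. p \<in> {1..N} \<Longrightarrow> p \<notin> Q \<Longrightarrow> x p = free_profile G p (\<phi> p)"
proof -
  define R where "R p = (if p \<in> {1..N} then \<phi> p / \<Phi> else 0)" for p
  define x where "x p = (if p \<in> {1..N} then
      if p \<in> Q then route_time_inv G p t else free_profile G p (\<phi> p) else (\<lambda>l. 0))" for p
  have R: "\<Phi> * R p = \<phi> p" if "p \<in> {1..N}" for p
    using that Phi by (simp add: R_def)
  have "(\<Sum>p=1..N. R p) = (\<Sum>p=1..N. \<phi> p) / \<Phi>"
    unfolding sum_divide_distrib by (rule sum.cong) (auto simp: R_def)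
  then have "routing_vector G R"
    using nonneg total Phi by (auto simp: routing_vector_def R_def)
  moreover have state: "route_density G p (x p) \<and> route_consistent G p (\<phi> p) (x p) \<and>
      t \<le> route_time G p (x p) \<and> (0 < \<phi> p \<longrightarrow> route_time G p (x p) = t)"
    if p: "p \<in> {1..N}" for p
  proof (cases "p \<in> Q")
    case True
    then show ?thesis
      using queued[OF p True] p route.route_time_inv_profile[OF route[OF p], of t]
        route.queue_profile_density[OF route[OF p], of "x p"]
        route.route_time_inv_consistent[OF route[OF p], of t "\<phi> p"]
      by (simp add: x_def)
  next
    case False
    then show ?thesis
      using free[OF p False] p route.free_profile_consistent[OF route[OF p] nonneg[OF p]]
      by (simp add: x_def)
  qed
  then have "density_vector G x" "consistent G \<Phi> R x"
    using R by (auto simp: density_vector_def consistent_def x_def)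
  moreover have pos: "0 < \<phi> p" if "p \<in> {1..N}" "0 < R p" for p
    using R[OF that(1)] Phi that(2) by (metis mult_pos_pos)
  moreover have time: "route_time G p (x p) = t" if "p \<in> {1..N}" "0 < R p" for p
    using state pos that by blast
  ultimately have "wardrop_equilibrium G \<Phi> R x" "used_routes_time G R x t"
    using state by (simp_all add: wardrop_equilibrium_def traffic_assignment_def used_routes_time_def)
  with R that[of R x] show thesis
    by (simp add: x_def)
qed

section \<open>The common travel time of an equilibrium\<close>

definition wardrop_level :: "(nat \<Rightarrow> real) \<Rightarrow> (nat \<Rightarrow> nat \<Rightarrow> real) \<Rightarrow> real \<Rightarrow> bool" where
  "wardrop_level R x t \<longleftrightarrow> wardrop_equilibrium G \<Phi> R x \<and> used_routes_time G R x t \<and>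
     (\<forall>p\<in>{1..N}. t \<le> route_time G p (x p))"

lemma routing_vectorD:
  assumes "wardrop_equilibrium G \<Phi> R x"
  shows "p \<in> {1..N} \<Longrightarrow> 0 \<le> R p" "p \<notin> {1..N} \<Longrightarrow> R p = 0" "(\<Sum>p=1..N. R p) = 1"
    "(\<Sum>p=1..N. \<Phi> * R p) = \<Phi>"
  using assms by (auto simp: wardrop_equilibrium_def traffic_assignment_def routing_vector_def
      sum_distrib_left[symmetric])

lemma used_route_exists:
  assumes w: "wardrop_equilibrium G \<Phi> R x"
  shows "\<exists>p\<in>{1..N}. 0 < R p"
proof (rule ccontr)
  assume "\<not> ?thesis"
  then have "(\<Sum>p=1..N. R p) \<le> 0"
    by (intro sum_nonpos) force
  then show False
    using routing_vectorD(3)[OF w] by simp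
qed

lemma wardrop_level_exists:
  assumes w: "wardrop_equilibrium G \<Phi> R x"
  obtains t where "wardrop_level R x t"
proof -
  obtain p where p: "p \<in> {1..N}" "0 < R p"
    using used_route_exists[OF w] by blast
  have le: "route_time G q (x q) \<le> route_time G i (x i)"
    if "q \<in> {1..N}" "0 < R q" "i \<in> {1..N}" for q i
    using w that by (auto simp: wardrop_equilibrium_def)
  have "wardrop_level R x (route_time G p (x p))"
    unfolding wardrop_level_def used_routes_time_def
    using w le[OF p] le[OF _ _ p(1)] by (auto intro: order.antisym)
  then show thesis
    by (rule that)
qed

lemma wardrop_level_unique:
  assumes "wardrop_level R x t" "used_routes_time G R x t'"
  shows "t' = t"
  using assms used_route_exists[of R x] by (auto simp: wardrop_level_def used_routes_time_def)

text \<open>Capacities are positive, so a route offered at least its capacity is used and has time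
  \<open>t\<close>. A route offered less is in free flow, so its free-flow time is at least
  \<open>t\<close>, with equality if it is used.\<close>

lemma wardrop_levelD:
  assumes w: "wardrop_level R x t" and p: "p \<in> {1..N}"
  shows "free_time G p < t \<Longrightarrow> cap p \<le> \<Phi> * R p"
    and "t < free_time G p \<Longrightarrow> R p = 0"
    and "cap p < \<Phi> * R p \<Longrightarrow> t = sat_time G p"
    and "cap p \<le> \<Phi> * R p \<Longrightarrow> free_time G p \<le> t \<and> t \<le> sat_time G p \<and> x p = route_time_inv G p t"
    and "\<Phi> * R p < cap p \<Longrightarrow> x p = free_profile G p (\<Phi> * R p)"
proof -
  have R: "0 \<le> R p"
    using w p routing_vectorD(1) by (auto simp: wardrop_level_def)
  then have nonneg: "0 \<le> \<Phi> * R p"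
    using Phi by simp
  have cap: "0 < cap p"
    using route.z_pos[OF route[OF p]] .
  have y: "route_density G p (x p)" "route_consistent G p (\<Phi> * R p) (x p)"
    using w p by (auto simp: wardrop_level_def wardrop_equilibrium_def traffic_assignment_def
        density_vector_def consistent_def)
  note state = route.route_state[OF route[OF p] y nonneg]
  have lower: "t \<le> route_time G p (x p)"
    using w p by (simp add: wardrop_level_def)
  have used: "route_time G p (x p) = t" if "R p \<noteq> 0"
    using that R w p by (auto simp: wardrop_level_def used_routes_time_def)
  show "free_time G p < t \<Longrightarrow> cap p \<le> \<Phi> * R p"
    using state(1) lower by force
  show upper: "free_time G p \<le> t \<and> t \<le> sat_time G p \<and> x p = route_time_inv G p t"
    if "cap p \<le> \<Phi> * R p"
    using state(2)[OF that] used that cap by fastforce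
  show "R p = 0" if "t < free_time G p"
    using state(1) upper used that by fastforce
  show "t = sat_time G p" if "cap p < \<Phi> * R p"
    using state(3)[OF that] used that cap by fastforce
  show "\<Phi> * R p < cap p \<Longrightarrow> x p = free_profile G p (\<Phi> * R p)"
    using state(1) by simp
qed

text \<open>Given routing and level, each density is either a free profile or an inverse travel
  time. Uniqueness of densities is thus reduced to uniqueness of the level.\<close>

lemma wardrop_density_unique:
  assumes w: "wardrop_level R x t" "wardrop_level R x' t"
  shows "x' = x"
proof
  fix p
  show "x' p = x p"
  proof (cases "p \<in> {1..N}")
    case True
    show ?thesis
      using wardrop_levelD(4,5)[OF w(1) True] wardrop_levelD(4,5)[OF w(2) True]
      by (cases "cap p \<le> \<Phi> * R p") auto
  next
    case False
    then show ?thesis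
      using w by (auto simp: wardrop_level_def wardrop_equilibrium_def traffic_assignment_def
          density_vector_def)
  qed
qed

lemma wardrop_routing_eqI:
  assumes "wardrop_equilibrium G \<Phi> R x" "wardrop_equilibrium G \<Phi> R' x'"
    and "\<And>p. p \<in> {1..N} \<Longrightarrow> \<Phi> * R' p = \<Phi> * R p"
  shows "R' = R"
proof
  fix p
  show "R' p = R p"
    using assms(3)[of p] Phi routing_vectorD(2)[OF assms(1)] routing_vectorD(2)[OF assms(2)]
    by (cases "p \<in> {1..N}") auto
qed

lemma flow_sum_support:
  assumes w: "wardrop_equilibrium G \<Phi> R x" and m: "m \<le> N"
    and zero: "\<And>p. p \<in> {1..N} \<Longrightarrow> m < p \<Longrightarrow> R p = 0"
  shows "(\<Sum>p=1..m. \<Phi> * R p) = \<Phi>"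
proof -
  have "(\<Sum>p=1..m. \<Phi> * R p) = (\<Sum>p=1..N. \<Phi> * R p)"
    using m zero by (intro sum.mono_neutral_left) auto
  then show ?thesis
    using routing_vectorD(4)[OF w] by simp
qed

end

section \<open>Routes filled in the order of their free-flow times\<close>

locale filled_game = routing_game +
  fixes k :: nat
  assumes A3: "distinct_times G" and k: "k \<in> {1..N}"
    and k_above: "\<Phi> \<le> (\<Sum>i=1..k. cap i)" and k_below: "(\<Sum>i\<in>{1..<k}. cap i) < \<Phi>"
begin

lemma free_time_less: "p \<in> {1..N} \<Longrightarrow> q \<in> {1..N} \<Longrightarrow> p < q \<Longrightarrow> free_time G p < free_time G q"
  using A3 by (simp add: distinct_times_def)

lemma free_time_le: "p \<in> {1..N} \<Longrightarrow> q \<in> {1..N} \<Longrightarrow> p \<le> q \<Longrightarrow> free_time G p \<le> free_time G q"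
  using free_time_less by (cases "p = q") (auto simp: less_imp_le)

lemma cap_pos: "p \<in> {1..N} \<Longrightarrow> 0 < cap p"
  using route route.z_pos by blast

lemma free_time_le_level:
  assumes w: "wardrop_level R x t" and sat: "\<And>p. p \<in> {1..k} \<Longrightarrow> t < sat_time G p"
  shows "free_time G k \<le> t"
proof (rule ccontr)
  assume "\<not> ?thesis"
  then have t: "t < free_time G k"
    by simp
  have eq: "wardrop_equilibrium G \<Phi> R x"
    using w by (simp add: wardrop_level_def)
  have zero: "R p = 0" if "p \<in> {1..N}" "k \<le> p" for p
    using wardrop_levelD(2)[OF w that(1)] free_time_le[OF k that] t by simp
  have "\<Phi> = (\<Sum>p=1..k. \<Phi> * R p)"
    using flow_sum_support[OF eq] zero k by simp
  also have "\<dots> = (\<Sum>p\<in>{1..<k}. \<Phi> * R p)"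
    using zero k by (intro sum.mono_neutral_right) auto
  also have "\<dots> \<le> (\<Sum>p\<in>{1..<k}. cap p)"
  proof (rule sum_mono)
    fix p assume "p \<in> {1..<k}"
    then have "p \<in> {1..k}" "p \<in> {1..N}"
      using k by auto
    then show "\<Phi> * R p \<le> cap p"
      using wardrop_levelD(3)[OF w, of p] sat[of p] by fastforce
  qed
  finally show False
    using k_below by simp
qed

lemma unsaturated_equilibrium_exists:
  assumes sat: "\<forall>p\<in>{1..k}. free_time G k < sat_time G p"
  obtains R x where "wardrop_equilibrium G \<Phi> R x" "used_routes_time G R x (free_time G k)"
    "\<And>p. p \<in> {1..<k} \<Longrightarrow> \<Phi> * R p = cap p" "\<Phi> * R k = \<Phi> - (\<Sum>i\<in>{1..<k}. cap i)"
    "\<And>p. p \<in> {k+1..N} \<Longrightarrow> \<Phi> * R p = 0"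
    "\<And>p. p \<in> {1..<k} \<Longrightarrow> x p = route_time_inv G p (free_time G k)"
    "x k = free_profile G k (\<Phi> - (\<Sum>i\<in>{1..<k}. cap i))"
proof -
  \<comment> \<open>Route \<open>k\<close> takes what the earlier ones cannot carry;
    \<open>k_below\<close> makes this positive and \<open>k_above\<close> bounds it by the capacity
    of \<open>k\<close>.\<close>
  define rest where "rest = \<Phi> - (\<Sum>i\<in>{1..<k}. cap i)"
  define \<phi> where "\<phi> p = (if p < k then cap p else if p = k then rest else 0)" for p
  have split: "(\<Sum>p=1..k. f p) = f k + (\<Sum>p\<in>{1..<k}. f p)" for f :: "nat \<Rightarrow> real"
    using sum_upto_last k by simp
  have rest: "0 < rest" "rest \<le> cap k"
    using k_above k_below unfolding rest_def split by simp_all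
  have "(\<Sum>p=1..N. \<phi> p) = (\<Sum>p=1..k. \<phi> p)"
    using k by (intro sum.mono_neutral_right) (auto simp: \<phi>_def)
  also have "\<dots> = \<phi> k + (\<Sum>p\<in>{1..<k}. \<phi> p)"
    by (rule split)
  also have "(\<Sum>p\<in>{1..<k}. \<phi> p) = (\<Sum>p\<in>{1..<k}. cap p)"
    by (rule sum.cong) (auto simp: \<phi>_def)
  finally have total: "(\<Sum>p=1..N. \<phi> p) = \<Phi>"
    by (simp add: \<phi>_def rest_def)
  show thesis
  proof (rule wardrop_equilibriumI[of \<phi> "{1..<k}" "free_time G k"])
    fix p assume p: "p \<in> {1..N}"
    show "0 \<le> \<phi> p"
      using rest cap_pos[OF p] by (auto simp: \<phi>_def)
    show "cap p \<le> \<phi> p \<and> free_time G p \<le> free_time G k \<and> free_time G k \<le> sat_time G p \<and>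
        (cap p < \<phi> p \<longrightarrow> free_time G k = sat_time G p)" if "p \<in> {1..<k}"
      using that free_time_le[OF p k] bspec[OF sat, of p] by (auto simp: \<phi>_def)
    show "\<phi> p \<le> cap p \<and> free_time G k \<le> free_time G p \<and> (0 < \<phi> p \<longrightarrow> free_time G p = free_time G k)"
      if "p \<notin> {1..<k}"
      using that free_time_le[OF k p] p rest cap_pos[OF p] by (auto simp: \<phi>_def)
  next
    fix R x
    assume *: "wardrop_equilibrium G \<Phi> R x" "used_routes_time G R x (free_time G k)"
      "\<And>p. p \<in> {1..N} \<Longrightarrow> \<Phi> * R p = \<phi> p"
      "\<And>p. p \<in> {1..N} \<Longrightarrow> p \<in> {1..<k} \<Longrightarrow> x p = route_time_inv G p (free_time G k)"
      "\<And>p. p \<in> {1..N} \<Longrightarrow> p \<notin> {1..<k} \<Longrightarrow> x p = free_profile G p (\<phi> p)"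
    have "\<phi> k = rest" "k \<notin> {1..<k}"
      by (simp_all add: \<phi>_def)
    with * that[of R x] k show thesis
      by (auto simp: \<phi>_def rest_def)
  qed (fact total)
qed

text \<open>The routing is forced at every possible level, but the level only if the first
  \<open>k\<close> routes have spare capacity. Otherwise all of them can lengthen their queues
  together, hence the premise of the last conjunct.\<close>

lemma unsaturated_equilibrium_routing:
  assumes sat: "\<forall>p\<in>{1..k}. free_time G k < sat_time G p"
    and w: "wardrop_level R x t"
  shows "(\<forall>p\<in>{1..<k}. \<Phi> * R p = cap p) \<and> \<Phi> * R k = \<Phi> - (\<Sum>i\<in>{1..<k}. cap i) \<and>
    (\<forall>p\<in>{k+1..N}. \<Phi> * R p = 0) \<and> (\<Phi> < (\<Sum>i=1..k. cap i) \<longrightarrow> t = free_time G k)"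
proof -
  have eq: "wardrop_equilibrium G \<Phi> R x"
    using w by (simp add: wardrop_level_def)
  have nonneg: "0 \<le> \<Phi> * R p" if "p \<in> {1..N}" for p
    using routing_vectorD(1)[OF eq that] Phi by simp
  have split: "(\<Sum>p=1..k. f p) = f k + (\<Sum>p\<in>{1..<k}. f p)" for f :: "nat \<Rightarrow> real"
    using sum_upto_last k by simp
  have level: "free_time G k \<le> t"
    using free_time_le_level[OF w] sat by (meson dual_order.strict_trans2 linorder_le_cases)
  have ge: "cap p \<le> \<Phi> * R p" if "p \<in> {1..N}" "p < k" for p
    using wardrop_levelD(1)[OF w that(1)] free_time_less[OF that(1) k that(2)] level by simp
  show ?thesis
  proof (cases "t = free_time G k")
    case True
    have low: "\<Phi> * R p = cap p" if "p \<in> {1..<k}" for p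
      using ge[of p] wardrop_levelD(3)[OF w, of p] bspec[OF sat, of p] that k True by force
    have high: "R p = 0" if "p \<in> {k+1..N}" for p
      using wardrop_levelD(2)[OF w, of p] free_time_less[of k p] that k True by simp
    have "(\<Sum>p=1..k. \<Phi> * R p) = \<Phi>"
      using flow_sum_support[OF eq] high k by simp
    moreover have "(\<Sum>p\<in>{1..<k}. \<Phi> * R p) = (\<Sum>p\<in>{1..<k}. cap p)"
      by (rule sum.cong) (simp_all add: low)
    ultimately have "\<Phi> * R k = \<Phi> - (\<Sum>i\<in>{1..<k}. cap i)"
      unfolding split by simp
    with low high True show ?thesis
      by simp
  next
    case False
    text \<open>Above the free-flow time of route \<open>k\<close>, all of the first \<open>k\<close> routes carry at least their
      capacity; as their capacities sum to at least the total flow, all bounds are attained.\<close>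
    then have "free_time G k < t"
      using level by simp
    then have ge: "cap p \<le> \<Phi> * R p" if "p \<in> {1..k}" for p
      using ge[of p] wardrop_levelD(1)[OF w k] that k by (cases "p = k") auto
    have "(\<Sum>p=1..N. \<Phi> * R p) = (\<Sum>p=1..k. \<Phi> * R p) + (\<Sum>p\<in>{k+1..N}. \<Phi> * R p)"
      using k by (subst sum.union_disjoint[symmetric]) (auto intro!: sum.cong)
    then have total: "(\<Sum>p=1..k. \<Phi> * R p) + (\<Sum>p\<in>{k+1..N}. \<Phi> * R p) = \<Phi>"
      using routing_vectorD(4)[OF eq] by simp
    have rest: "0 \<le> (\<Sum>p\<in>{k+1..N}. \<Phi> * R p)"
      using nonneg by (intro sum_nonneg) auto
    have le: "(\<Sum>p=1..k. cap p) \<le> (\<Sum>p=1..k. \<Phi> * R p)"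
      using ge by (rule sum_mono)
    have exact: "(\<Sum>p=1..k. cap p) = \<Phi>" "(\<Sum>p=1..k. cap p) = (\<Sum>p=1..k. \<Phi> * R p)"
      "(\<Sum>p\<in>{k+1..N}. \<Phi> * R p) = 0"
      using total rest le k_above by simp_all
    have "\<forall>p\<in>{1..k}. \<Phi> * R p - cap p = 0"
      using exact(2) ge by (subst sum_nonneg_eq_0_iff[symmetric]) (auto simp: sum_subtractf)
    moreover have "\<forall>p\<in>{k+1..N}. \<Phi> * R p = 0"
      using exact(3) nonneg by (subst sum_nonneg_eq_0_iff[symmetric]) auto
    ultimately show ?thesis
      using exact(1) k unfolding split by simp
  qed
qed

section \<open>Equilibria whose surplus waits on the route with least saturated time\<close>

lemma saturated_level:
  assumes u: "u \<in> {1..<j}" and j: "j \<le> k" and uj: "sat_time G u \<le> free_time G j"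
    and sat: "\<forall>p\<in>{1..N} - {u}. sat_time G u < sat_time G p"
    and w: "wardrop_level R x t"
  shows "t = sat_time G u"
proof -
  have uN: "u \<in> {1..N}" and jN: "j \<in> {1..N}"
    using u j k by auto
  have "sat_time G u \<le> free_time G k"
    using uj free_time_le[OF jN k j] by simp
  \<comment> \<open>A level below the saturated time of \<open>u\<close> is below all saturated
    times of the first \<open>k\<close> routes; \<open>free_time_le_level\<close> would then lift it
    to \<open>free_time G k\<close>, which is no smaller than that of \<open>u\<close>.\<close>
  moreover have "t < sat_time G p" if "p \<in> {1..k}" "t < sat_time G u" for p
    using bspec[OF sat, of p] that k by (cases "p = u") auto
  ultimately have "sat_time G u \<le> t"
    using free_time_le_level[OF w] by force
  \<comment> \<open>A higher level would exceed the free-flow time of \<open>u\<close>, so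
    \<open>u\<close> would carry its capacity, and then its saturated time bounds the level.\<close>
  moreover have "t \<le> sat_time G u"
    using wardrop_levelD(1,4)[OF w uN] route.free_time_le_sat_time[OF route[OF uN]]
    by force
  ultimately show ?thesis
    by simp
qed

text \<open>With the level fixed, every route before \<open>j\<close> except \<open>u\<close> lies
  strictly between its free and saturated times and so carries exactly its capacity; routes after
  \<open>j\<close> are too slow. Only the split of the remainder between \<open>u\<close> and
  \<open>j\<close> stays open.\<close>

lemma saturated_equilibrium_routing:
  assumes u: "u \<in> {1..<j}" and j: "j \<le> k" and uj: "sat_time G u \<le> free_time G j"
    and below: "\<forall>p\<in>{1..<j} - {u}. free_time G p < sat_time G u"
    and sat: "\<forall>p\<in>{1..N} - {u}. sat_time G u < sat_time G p"
    and w: "wardrop_level R x t"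
  shows "t = sat_time G u"
    and "p \<in> {1..<j} - {u} \<Longrightarrow> \<Phi> * R p = cap p"
    and "p \<in> {j+1..N} \<Longrightarrow> R p = 0"
    and "sat_time G u < free_time G j \<Longrightarrow> R j = 0"
    and "\<Phi> * R j \<le> cap j"
    and "\<Phi> * R u + \<Phi> * R j = \<Phi> - (\<Sum>i\<in>{1..<j} - {u}. cap i)"
proof -
  have eq: "wardrop_equilibrium G \<Phi> R x"
    using w by (simp add: wardrop_level_def)
  have jN: "j \<in> {1..N}"
    using u j k by auto
  show t: "t = sat_time G u"
    using saturated_level[OF u j uj sat w] .
  have low: "\<Phi> * R p = cap p" if "p \<in> {1..<j} - {u}" for p
  proof -
    have p: "p \<in> {1..N}" "p \<noteq> u"
      using that jN by auto
    show ?thesis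
      using wardrop_levelD(1,3)[OF w p(1)] bspec[OF below that] bspec[OF sat, of p] p t by fastforce
  qed
  then show "p \<in> {1..<j} - {u} \<Longrightarrow> \<Phi> * R p = cap p" .
  have high: "R p = 0" if "p \<in> {j+1..N}" for p
    using wardrop_levelD(2)[OF w, of p] free_time_less[OF jN, of p] that uj t by auto
  then show "p \<in> {j+1..N} \<Longrightarrow> R p = 0" .
  show "sat_time G u < free_time G j \<Longrightarrow> R j = 0"
    using wardrop_levelD(2)[OF w jN] t by simp
  show "\<Phi> * R j \<le> cap j"
    using wardrop_levelD(3)[OF w jN] bspec[OF sat, of j] jN u t by force
  have "(\<Sum>p=1..j. \<Phi> * R p) = \<Phi>"
    using flow_sum_support[OF eq] high jN by simp
  moreover have "{1..j} = insert u (insert j ({1..<j} - {u}))"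
    using u by auto
  moreover have "(\<Sum>p\<in>{1..<j} - {u}. \<Phi> * R p) = (\<Sum>p\<in>{1..<j} - {u}. cap p)"
    by (rule sum.cong) (simp_all add: low)
  ultimately show "\<Phi> * R u + \<Phi> * R j = \<Phi> - (\<Sum>i\<in>{1..<j} - {u}. cap i)"
    using u by simp
qed

text \<open>Any split of the remainder works if \<open>u\<close> gets at least its capacity and
  \<open>j\<close> at most its own; \<open>j\<close> may get a positive share only if its free-flow
  time ties with the level.\<close>

lemma saturated_equilibrium_exists:
  assumes u: "u \<in> {1..<j}" and j: "j \<le> k" and uj: "sat_time G u \<le> free_time G j"
    and below: "\<forall>p\<in>{1..<j} - {u}. free_time G p < sat_time G u"
    and sat: "\<forall>p\<in>{1..N} - {u}. sat_time G u < sat_time G p"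
    and r: "cap u \<le> r" "r + s = \<Phi> - (\<Sum>i\<in>{1..<j} - {u}. cap i)"
    and s: "0 \<le> s" "s \<le> cap j" "0 < s \<Longrightarrow> free_time G j = sat_time G u"
  shows "\<exists>R x. wardrop_equilibrium G \<Phi> R x \<and> used_routes_time G R x (sat_time G u) \<and>
    \<Phi> * R u = r \<and> (\<forall>p\<in>{1..<j}. x p = route_time_inv G p (sat_time G u))"
proof -
  define \<phi> where "\<phi> p = (if p = u then r else if p < j then cap p else if p = j then s else 0)" for p
  have jN: "j \<in> {1..N}" and uN: "u \<in> {1..N}"
    using u j k by auto
  have "(\<Sum>p=1..N. \<phi> p) = (\<Sum>p=1..j. \<phi> p)"
    using jN u by (intro sum.mono_neutral_right) (auto simp: \<phi>_def)
  also have "{1..j} = insert u (insert j ({1..<j} - {u}))"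
    using u by auto
  also have "(\<Sum>p\<in>\<dots>. \<phi> p) = \<phi> u + \<phi> j + (\<Sum>p\<in>{1..<j} - {u}. \<phi> p)"
    using u by simp
  also have "(\<Sum>p\<in>{1..<j} - {u}. \<phi> p) = (\<Sum>p\<in>{1..<j} - {u}. cap p)"
    by (rule sum.cong) (auto simp: \<phi>_def)
  finally have total: "(\<Sum>p=1..N. \<phi> p) = \<Phi>"
    using r u by (simp add: \<phi>_def)
  show ?thesis
  proof (rule wardrop_equilibriumI[of \<phi> "{1..<j}" "sat_time G u"])
    fix p assume p: "p \<in> {1..N}"
    show "0 \<le> \<phi> p"
      using r s cap_pos[OF p] by (auto simp: \<phi>_def)
    show "cap p \<le> \<phi> p \<and> free_time G p \<le> sat_time G u \<and> sat_time G u \<le> sat_time G p \<and>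
        (cap p < \<phi> p \<longrightarrow> sat_time G u = sat_time G p)" if "p \<in> {1..<j}"
      using that bspec[OF below, of p] bspec[OF sat, of p] p r route.free_time_le_sat_time[OF route[OF p]]
      by (cases "p = u") (auto simp: \<phi>_def)
    show "\<phi> p \<le> cap p \<and> sat_time G u \<le> free_time G p \<and> (0 < \<phi> p \<longrightarrow> free_time G p = sat_time G u)"
      if "p \<notin> {1..<j}"
      using that free_time_le[OF jN p] p s u uj cap_pos[OF p] by (auto simp: \<phi>_def)
  next
    fix R x
    assume *: "wardrop_equilibrium G \<Phi> R x" "used_routes_time G R x (sat_time G u)"
      "\<And>p. p \<in> {1..N} \<Longrightarrow> \<Phi> * R p = \<phi> p"
      "\<And>p. p \<in> {1..N} \<Longrightarrow> p \<in> {1..<j} \<Longrightarrow> x p = route_time_inv G p (sat_time G u)"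
    have "\<phi> u = r"
      by (simp add: \<phi>_def)
    with * uN jN show ?thesis
      by (intro exI[of _ R] exI[of _ x]) auto
  qed (fact total)
qed

end

text \<open>The minimum of \<open>U\<close> is taken with respect to saturated time. If
  \<open>u = k\<close> and the bottleneck of \<open>k\<close> is its first link, then
  \<open>k\<close> has equal free and saturated times and \<open>J\<close> is empty; this case is
  set apart. In the tie case the lower end of the interval can fall below \<open>z u\<close> when
  \<open>j = k\<close>, while \<open>u\<close> always carries at least \<open>z u\<close>; hence the
  restriction on the attained values \<open>r\<close>.\<close>

theorem theorem1:
  fixes G :: network and \<Phi> :: real and k u j :: nat and U J :: "nat set"
    and z :: "nat \<Rightarrow> real"
  assumes net: "parallel_network G" and Phi: "\<Phi> > 0"
    and A1: "unique_bottlenecks G"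
    and A2: "\<Phi> \<le> (\<Sum>p=1..routes G. route_capacity G p)"
    and A3: "distinct_times G"
    and z: "z = route_capacity G"
    and k: "k = Min {p \<in> {1..routes G}. \<Phi> - (\<Sum>i=1..p. z i) \<le> 0}"
    and U: "U = {p \<in> {1..k}. \<exists>i\<in>{1..k}. sat_time G p \<le> free_time G i}"
    and u: "u = arg_min_on (sat_time G) U"
    and J: "J = {p \<in> {u+1..k}. free_time G p \<ge> sat_time G u}"
    and j: "j = Min J"
  shows
    "(U = {} \<longrightarrow>
       (\<exists>R x. wardrop_equilibrium G \<Phi> R x \<and> fully_transferring G \<Phi> R \<and>
          (\<forall>p\<in>{1..<k}. \<Phi> * R p = z p) \<and>
          \<Phi> * R k = \<Phi> - (\<Sum>i\<in>{1..<k}. z i) \<and>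
          (\<forall>p\<in>{k+1..routes G}. \<Phi> * R p = 0) \<and>
          (\<forall>p\<in>{1..<k}. x p = route_time_inv G p (free_time G k)) \<and>
          (\<forall>l\<in>{1..links G k}. x k l = (\<Phi> - (\<Sum>i\<in>{1..<k}. z i)) / free_speed G k l) \<and>
          used_routes_time G R x (free_time G k) \<and>
          (\<forall>R' x'. wardrop_equilibrium G \<Phi> R' x' \<longrightarrow>
             R' = R \<and>
             (\<Phi> < (\<Sum>i=1..k. z i) \<or> used_routes_time G R' x' (free_time G k) \<longrightarrow> x' = x))))
     \<and>
     (U \<noteq> {} \<and> (bottleneck G k = 1 \<longrightarrow> u \<noteq> k) \<longrightarrow>
       J \<noteq> {} \<and>
       (free_time G j > sat_time G u \<longrightarrow>
         (\<exists>R x. wardrop_equilibrium G \<Phi> R x \<and> partially_transferring G \<Phi> R \<and>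
            (\<forall>p\<in>{1..<j} - {u}. \<Phi> * R p = z p) \<and>
            \<Phi> * R u = \<Phi> - (\<Sum>i\<in>{1..<j} - {u}. z i) \<and>
            (\<forall>p\<in>{j..routes G}. \<Phi> * R p = 0) \<and>
            (\<forall>p\<in>{1..<j}. x p = route_time_inv G p (sat_time G u)) \<and>
            used_routes_time G R x (sat_time G u) \<and>
            (\<forall>R' x'. wardrop_equilibrium G \<Phi> R' x' \<longrightarrow> R' = R \<and> x' = x)))
       \<and>
       (free_time G j = sat_time G u \<longrightarrow>
         (\<forall>R x. wardrop_equilibrium G \<Phi> R x \<longrightarrow>
            (\<forall>p\<in>{1..<j} - {u}. \<Phi> * R p = z p) \<and>
            \<Phi> * R u \<in> {\<Phi> - (\<Sum>i\<in>{1..j} - {u}. z i) .. \<Phi> - (\<Sum>i\<in>{1..<j} - {u}. z i)} \<and>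
            \<Phi> * R j = \<Phi> * (1 - (\<Sum>i\<in>{1..<j}. R i)) \<and>
            (\<forall>p\<in>{j+1..routes G}. \<Phi> * R p = 0) \<and>
            (\<forall>p\<in>{1..<j}. x p = route_time_inv G p (sat_time G u)) \<and>
            (\<forall>l\<in>{1..links G j}.
               x j l = \<Phi> * (1 - (\<Sum>i\<in>{1..<j}. R i)) / free_speed G j l) \<and>
            (j < k \<longrightarrow> partially_transferring G \<Phi> R \<and>
               used_routes_time G R x (free_time G j)) \<and>
            (j = k \<longrightarrow> (fully_transferring G \<Phi> R \<longleftrightarrow> \<Phi> * R u = z u) \<and>
               used_routes_time G R x (free_time G k))) \<and>
         (\<exists>R x. wardrop_equilibrium G \<Phi> R x) \<and>
         (\<forall>r\<in>{\<Phi> - (\<Sum>i\<in>{1..j} - {u}. z i) .. \<Phi> - (\<Sum>i\<in>{1..<j} - {u}. z i)}.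
            z u \<le> r \<longrightarrow> (\<exists>R x. wardrop_equilibrium G \<Phi> R x \<and> \<Phi> * R u = r))))"
proof -
  let ?K = "{p \<in> {1..routes G}. \<Phi> - (\<Sum>i=1..p. z i) \<le> 0}"
  \<comment> \<open>A2 says that all routes together suffice, so the minimum defining
    \<open>k\<close> is over a nonempty set.\<close>
  have "routes G \<in> ?K"
    using net A2 by (simp add: parallel_network_def z)
  then have kK: "k \<in> ?K"
    unfolding k by (intro Min_in) auto
  have k_less: "(\<Sum>i\<in>{1..<k}. z i) < \<Phi>"
  proof (cases "k = 1")
    case True
    then show ?thesis
      using Phi by simp
  next
    case False
    have "k \<le> i" if "i \<in> ?K" for i
      unfolding k using that by (intro Min_le) auto
    then have "k - 1 \<notin> ?K"
      using kK False by fastforce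
    moreover have "{1..k - 1} = {1..<k}" "k - 1 \<in> {1..routes G}"
      using kK False by auto
    ultimately show ?thesis
      by simp
  qed
  interpret filled_game G \<Phi> k
    using net Phi A1 A3 kK k_less by unfold_locales (auto simp: z)
  \<comment> \<open>Free-flow times increase, so \<open>i = k\<close> is the weakest test for
    membership.\<close>
  have U_iff: "p \<in> U \<longleftrightarrow> p \<in> {1..k} \<and> sat_time G p \<le> free_time G k" for p
  proof -
    have "free_time G i \<le> free_time G k" if "i \<in> {1..k}" for i
      using free_time_le[of i k] that kK by simp
    then show ?thesis
      using kK unfolding U by fastforce
  qed
  show ?thesis
  proof (intro conjI impI)
    assume "U = {}"
    then have sat: "\<forall>p\<in>{1..k}. free_time G k < sat_time G p"
      using U_iff by (meson empty_iff not_le)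
    obtain R x where R: "wardrop_equilibrium G \<Phi> R x" "used_routes_time G R x (free_time G k)"
      "\<And>p. p \<in> {1..<k} \<Longrightarrow> \<Phi> * R p = z p" "\<Phi> * R k = \<Phi> - (\<Sum>i\<in>{1..<k}. z i)"
      "\<And>p. p \<in> {k+1..N} \<Longrightarrow> \<Phi> * R p = 0"
      "\<And>p. p \<in> {1..<k} \<Longrightarrow> x p = route_time_inv G p (free_time G k)"
      "x k = free_profile G k (\<Phi> - (\<Sum>i\<in>{1..<k}. z i))"
      using unsaturated_equilibrium_exists[OF sat] unfolding z by metis
    obtain t where "wardrop_level R x t"
      using wardrop_level_exists[OF R(1)] .
    then have level: "wardrop_level R x (free_time G k)"
      using wardrop_level_unique R(2) by blast
    have "\<Phi> * R k \<le> z k"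
      using R(4) kK sum_upto_last[of k z] by simp
    then have "\<Phi> * R p \<le> z p" if "p \<in> {1..N}" for p
      using that R(3)[of p] R(5)[of p] cap_pos[OF that] by (cases p k rule: linorder_cases) (auto simp: z)
    then have full: "fully_transferring G \<Phi> R"
      by (fastforce simp: fully_transferring_def partially_transferring_def z)
    have density: "x k l = (\<Phi> - (\<Sum>i\<in>{1..<k}. z i)) / free_speed G k l"
      if "l \<in> {1..links G k}" for l
      using that unfolding R(7) free_profile_def by (rule if_P)
    have unique: "R' = R \<and>
        (\<Phi> < (\<Sum>i=1..k. z i) \<or> used_routes_time G R' x' (free_time G k) \<longrightarrow> x' = x)"
      if w': "wardrop_equilibrium G \<Phi> R' x'" for R' x'
    proof -
      obtain t where t: "wardrop_level R' x' t"
        using wardrop_level_exists[OF w'] .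
      note R' = unsaturated_equilibrium_routing[OF sat t, folded z]
      have "\<Phi> * R' p = \<Phi> * R p" if p: "p \<in> {1..N}" for p
      proof -
        consider "p \<in> {1..<k}" | "p = k" | "p \<in> {k+1..N}"
          using p by fastforce
        then show ?thesis
          using R' R(3-5) by cases metis+
      qed
      then have eq: "R' = R"
        using wardrop_routing_eqI[OF R(1) w'] by blast
      moreover have "x' = x" if "\<Phi> < (\<Sum>i=1..k. z i) \<or> used_routes_time G R' x' (free_time G k)"
      proof -
        \<comment> \<open>Either spare capacity forces the level, or the prescribed time of the used
          routes does.\<close>
        have "t = free_time G k"
          using that R' wardrop_level_unique[OF t] by blast
        then have "wardrop_level R x' (free_time G k)"
          using t eq by simp
        then show ?thesis
          by (rule wardrop_density_unique[OF level])
      qed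
      ultimately show ?thesis
        by blast
    qed
    show "\<exists>R x. wardrop_equilibrium G \<Phi> R x \<and> fully_transferring G \<Phi> R \<and>
          (\<forall>p\<in>{1..<k}. \<Phi> * R p = z p) \<and>
          \<Phi> * R k = \<Phi> - (\<Sum>i\<in>{1..<k}. z i) \<and>
          (\<forall>p\<in>{k+1..routes G}. \<Phi> * R p = 0) \<and>
          (\<forall>p\<in>{1..<k}. x p = route_time_inv G p (free_time G k)) \<and>
          (\<forall>l\<in>{1..links G k}. x k l = (\<Phi> - (\<Sum>i\<in>{1..<k}. z i)) / free_speed G k l) \<and>
          used_routes_time G R x (free_time G k) \<and>
          (\<forall>R' x'. wardrop_equilibrium G \<Phi> R' x' \<longrightarrow>
             R' = R \<and>
             (\<Phi> < (\<Sum>i=1..k. z i) \<or> used_routes_time G R' x' (free_time G k) \<longrightarrow> x' = x))"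
      using unique by (intro exI[of _ R] exI[of _ x] conjI ballI R full density) auto
  next
    assume ne: "U \<noteq> {} \<and> (bottleneck G k = 1 \<longrightarrow> u \<noteq> k)"
    have finU: "finite U"
      by (simp add: U)
    have uU: "u \<in> U" and u_min: "\<And>p. p \<in> U \<Longrightarrow> sat_time G u \<le> sat_time G p"
      using ne arg_min_if_finite[OF finU, of "sat_time G"] unfolding u by (auto simp: not_less)
    have u_sat: "sat_time G u \<le> free_time G k" and uk: "u \<in> {1..k}"
      using uU U_iff by auto
    \<comment> \<open>Otherwise the saturated time of \<open>k\<close> would not exceed its
      free-flow time, so its bottleneck would be its first link.\<close>
    have "u \<noteq> k"
      using ne u_sat route.free_time_less_sat_time[OF route, of k] kK by fastforce
    then have kJ: "k \<in> J"
      using uk u_sat by (simp add: J)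
    then show "J \<noteq> {}"
      by blast
    have finJ: "finite J"
      by (simp add: J)
    have "j \<in> J"
      using Min_in[OF finJ] kJ j by blast
    then have uj: "u \<in> {1..<j}" and jk: "j \<le> k" and j_sat: "sat_time G u \<le> free_time G j"
      using uk by (auto simp: J)
    have jN: "j \<in> {1..N}" and uN: "u \<in> {1..N}"
      using jk uj kK by auto
    have below: "\<forall>p\<in>{1..<j} - {u}. free_time G p < sat_time G u"
    proof
      fix p assume p: "p \<in> {1..<j} - {u}"
      show "free_time G p < sat_time G u"
      proof (cases "p < u")
        case True
        then show ?thesis
          using free_time_less[of p u] route.free_time_le_sat_time[OF route[OF uN]] p uN by simp
      next
        case False
        then have "p \<in> {u+1..k}" "p \<notin> J"
          using p jk Min_le[OF finJ, of p] j by auto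
        then show ?thesis
          by (simp add: J)
      qed
    qed
    \<comment> \<open>Members of \<open>U\<close> are handled by the choice of \<open>u\<close>; all
      other routes have saturated times above \<open>free_time G k\<close>. Distinctness makes the
      inequality strict.\<close>
    have sat: "\<forall>p\<in>{1..N} - {u}. sat_time G u < sat_time G p"
    proof
      fix p assume "p \<in> {1..N} - {u}"
      then have p: "p \<in> {1..N}" "p \<noteq> u"
        by auto
      have "sat_time G u \<le> sat_time G p"
      proof (cases "p \<le> k")
        case True
        then show ?thesis
          using u_min[of p] U_iff[of p] u_sat p by fastforce
      next
        case False
        then show ?thesis
          using free_time_less[of k p] route.free_time_le_sat_time[OF route[OF p(1)]] p kK u_sat
          by simp
      qed
      moreover have "sat_time G u \<noteq> sat_time G p"
        using A3 p uN by (simp add: distinct_times_def)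
      ultimately show "sat_time G u < sat_time G p"
        by simp
    qed
    define S where "S = (\<Sum>i\<in>{1..<j} - {u}. z i)"
    have "{1..<j} = insert u ({1..<j} - {u})"
      using uj by auto
    then have sum_j: "(\<Sum>i\<in>{1..<j}. f i) = f u + (\<Sum>i\<in>{1..<j} - {u}. f i)" for f :: "nat \<Rightarrow> real"
      by (metis Diff_iff finite_Diff finite_atLeastLessThan insertI1 sum.insert)
    have "{1..j} - {u} = insert j ({1..<j} - {u})"
      using uj by auto
    then have S_j: "(\<Sum>i\<in>{1..j} - {u}. z i) = z j + S"
      by (simp add: S_def)
    have "(\<Sum>i\<in>{1..<j}. z i) \<le> (\<Sum>i\<in>{1..<k}. z i)"
      using jk kK cap_pos by (intro sum_mono2) (auto simp: z less_imp_le)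
    then have u_less: "z u < \<Phi> - S"
      using k_less sum_j[of z] by (simp add: S_def)
    have S_r: "r + (\<Phi> - S - r) = \<Phi> - S" for r
      by simp
    note exists = saturated_equilibrium_exists[OF uj jk j_sat below sat, folded z, folded S_def,
        OF _ S_r]
    note routing = saturated_equilibrium_routing[OF uj jk j_sat below sat, folded z, folded S_def]
    {
      assume gt: "sat_time G u < free_time G j"
      obtain R x where R: "wardrop_equilibrium G \<Phi> R x" "used_routes_time G R x (sat_time G u)"
        "\<Phi> * R u = \<Phi> - S" "\<And>p. p \<in> {1..<j} \<Longrightarrow> x p = route_time_inv G p (sat_time G u)"
        using exists[of "\<Phi> - S"] u_less cap_pos[OF jN] unfolding z by auto
      obtain t where t: "wardrop_level R x t"
        using wardrop_level_exists[OF R(1)] .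
      have "\<Phi> * R p = 0" if "p \<in> {j..N}" for p
        using routing(3,4)[OF t] gt that by (cases "p = j") auto
      moreover have "partially_transferring G \<Phi> R"
        using R(3) u_less uN unfolding partially_transferring_def z
        by (intro bexI[of _ u]) simp_all
      moreover have "R' = R \<and> x' = x" if w': "wardrop_equilibrium G \<Phi> R' x'" for R' x'
      proof -
        obtain t' where t': "wardrop_level R' x' t'"
          using wardrop_level_exists[OF w'] .
        have "\<Phi> * R' p = \<Phi> * R p" if p: "p \<in> {1..N}" for p
        proof -
          consider "p \<in> {1..<j} - {u}" | "p = u" | "p = j" | "p \<in> {j+1..N}"
            using p by fastforce
          then show ?thesis
            using routing[OF t] routing[OF t'] gt by cases auto
        qed
        then have "R' = R"
          using wardrop_routing_eqI[OF R(1) w'] by blast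
        moreover from this have "x' = x"
          using routing(1)[OF t] routing(1)[OF t'] t t' wardrop_density_unique by metis
        ultimately show ?thesis
          by simp
      qed
      ultimately show "\<exists>R x. wardrop_equilibrium G \<Phi> R x \<and> partially_transferring G \<Phi> R \<and>
            (\<forall>p\<in>{1..<j} - {u}. \<Phi> * R p = z p) \<and>
            \<Phi> * R u = \<Phi> - (\<Sum>i\<in>{1..<j} - {u}. z i) \<and>
            (\<forall>p\<in>{j..routes G}. \<Phi> * R p = 0) \<and>
            (\<forall>p\<in>{1..<j}. x p = route_time_inv G p (sat_time G u)) \<and>
            used_routes_time G R x (sat_time G u) \<and>
            (\<forall>R' x'. wardrop_equilibrium G \<Phi> R' x' \<longrightarrow> R' = R \<and> x' = x)"
        using R routing(2)[OF t] unfolding S_def by (intro exI[of _ R] exI[of _ x]) blast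
    next
      assume eq: "free_time G j = sat_time G u"
      have u_free: "free_time G u < sat_time G u"
        using free_time_less[OF uN jN] uj eq by simp
      show "\<exists>R x. wardrop_equilibrium G \<Phi> R x"
        using exists[of "\<Phi> - S"] u_less cap_pos[OF jN] unfolding z by auto
      show "\<forall>r\<in>{\<Phi> - (\<Sum>i\<in>{1..j} - {u}. z i) .. \<Phi> - (\<Sum>i\<in>{1..<j} - {u}. z i)}.
            z u \<le> r \<longrightarrow> (\<exists>R x. wardrop_equilibrium G \<Phi> R x \<and> \<Phi> * R u = r)"
      proof (intro ballI impI)
        fix r
        assume "r \<in> {\<Phi> - (\<Sum>i\<in>{1..j} - {u}. z i) .. \<Phi> - (\<Sum>i\<in>{1..<j} - {u}. z i)}" "z u \<le> r"
        then show "\<exists>R x. wardrop_equilibrium G \<Phi> R x \<and> \<Phi> * R u = r"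
          using exists[of r] eq unfolding S_j S_def[symmetric] by auto
      qed
      show "\<forall>R x. wardrop_equilibrium G \<Phi> R x \<longrightarrow>
            (\<forall>p\<in>{1..<j} - {u}. \<Phi> * R p = z p) \<and>
            \<Phi> * R u \<in> {\<Phi> - (\<Sum>i\<in>{1..j} - {u}. z i) .. \<Phi> - (\<Sum>i\<in>{1..<j} - {u}. z i)} \<and>
            \<Phi> * R j = \<Phi> * (1 - (\<Sum>i\<in>{1..<j}. R i)) \<and>
            (\<forall>p\<in>{j+1..routes G}. \<Phi> * R p = 0) \<and>
            (\<forall>p\<in>{1..<j}. x p = route_time_inv G p (sat_time G u)) \<and>
            (\<forall>l\<in>{1..links G j}.
               x j l = \<Phi> * (1 - (\<Sum>i\<in>{1..<j}. R i)) / free_speed G j l) \<and>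
            (j < k \<longrightarrow> partially_transferring G \<Phi> R \<and>
               used_routes_time G R x (free_time G j)) \<and>
            (j = k \<longrightarrow> (fully_transferring G \<Phi> R \<longleftrightarrow> \<Phi> * R u = z u) \<and>
               used_routes_time G R x (free_time G k))"
      proof (intro allI impI)
        fix R x assume w: "wardrop_equilibrium G \<Phi> R x"
        obtain t where "wardrop_level R x t"
          using wardrop_level_exists[OF w] .
        then have t: "wardrop_level R x (sat_time G u)"
          using routing(1) by metis
        note R = routing(2-6)[OF t]
        have Rj: "0 \<le> \<Phi> * R j"
          using routing_vectorD(1)[OF w jN] Phi by simp
        have Ru: "z u \<le> \<Phi> * R u"
          using wardrop_levelD(1)[OF t uN] u_free by (simp add: z)
        have range: "\<Phi> * R u \<in> {\<Phi> - (\<Sum>i\<in>{1..j} - {u}. z i) .. \<Phi> - (\<Sum>i\<in>{1..<j} - {u}. z i)}"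
          using R(4,5) Rj unfolding S_j S_def[symmetric] by simp
        have "(\<Sum>i\<in>{1..<j} - {u}. \<Phi> * R i) = S"
          unfolding S_def by (rule sum.cong) (simp_all add: R(1))
        then have rest: "\<Phi> * R j = \<Phi> * (1 - (\<Sum>i\<in>{1..<j}. R i))"
          using R(5) sum_j[of "\<lambda>i. \<Phi> * R i"] by (simp add: right_diff_distrib sum_distrib_left)
        have used: "used_routes_time G R x (sat_time G u)"
          using t by (simp add: wardrop_level_def)
        have queues: "x p = route_time_inv G p (sat_time G u)" if "p \<in> {1..<j}" for p
          using wardrop_levelD(4)[OF t, of p] R(1)[of p] Ru that jN by (cases "p = u") (auto simp: z)
        \<comment> \<open>At full capacity the density is given by the inverse at time
          \<open>free_time G j\<close>, and there the queue is empty.\<close>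
        have xj: "x j = free_profile G j (\<Phi> * R j)"
        proof (cases "\<Phi> * R j < z j")
          case True
          then show ?thesis
            using wardrop_levelD(5)[OF t jN] by (simp add: z)
        next
          case False
          then have "\<Phi> * R j = z j"
            using R(4) by simp
          then show ?thesis
            using wardrop_levelD(4)[OF t jN] route.route_time_inv_free[OF route[OF jN]] eq
            by (simp add: z)
        qed
        \<comment> \<open>For \<open>j < k\<close> even a full route \<open>j\<close> leaves a
          surplus, which only \<open>u\<close> can take.\<close>
        have partial: "partially_transferring G \<Phi> R" if "j < k"
        proof -
          have "(\<Sum>i\<in>{1..<j}. z i) + z j = (\<Sum>i\<in>{1..j}. z i)"
            using sum_upto_last[of j z] jN by simp
          also have "\<dots> \<le> (\<Sum>i\<in>{1..<k}. z i)"
            using that kK cap_pos by (intro sum_mono2) (auto simp: z less_imp_le)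
          finally have "z u < \<Phi> * R u"
            using k_less R(4,5) sum_j[of z] by (simp add: S_def)
          then show ?thesis
            using uN unfolding partially_transferring_def z by blast
        qed
        have "\<Phi> * R p \<le> z p" if p: "p \<in> {1..N}" "p \<noteq> u" for p
        proof -
          consider "p \<in> {1..<j} - {u}" | "p = j" | "p \<in> {j+1..N}"
            using p by fastforce
          then show ?thesis
            using R(1,2,4) cap_pos[OF p(1)] by cases (auto simp: z)
        qed
        then have full: "fully_transferring G \<Phi> R \<longleftrightarrow> \<Phi> * R u = z u"
          using Ru uN unfolding fully_transferring_def partially_transferring_def z
          by (metis less_irrefl linorder_not_le order.antisym)
        have "j = k \<Longrightarrow> used_routes_time G R x (free_time G k)"
          using used eq by simp
        with R(1,2) range rest queues xj partial full used eq
        show "(\<forall>p\<in>{1..<j} - {u}. \<Phi> * R p = z p) \<and>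
            \<Phi> * R u \<in> {\<Phi> - (\<Sum>i\<in>{1..j} - {u}. z i) .. \<Phi> - (\<Sum>i\<in>{1..<j} - {u}. z i)} \<and>
            \<Phi> * R j = \<Phi> * (1 - (\<Sum>i\<in>{1..<j}. R i)) \<and>
            (\<forall>p\<in>{j+1..routes G}. \<Phi> * R p = 0) \<and>
            (\<forall>p\<in>{1..<j}. x p = route_time_inv G p (sat_time G u)) \<and>
            (\<forall>l\<in>{1..links G j}.
               x j l = \<Phi> * (1 - (\<Sum>i\<in>{1..<j}. R i)) / free_speed G j l) \<and>
            (j < k \<longrightarrow> partially_transferring G \<Phi> R \<and>
               used_routes_time G R x (free_time G j)) \<and>
            (j = k \<longrightarrow> (fully_transferring G \<Phi> R \<longleftrightarrow> \<Phi> * R u = z u) \<and>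
               used_routes_time G R x (free_time G k))"
          by (simp add: free_profile_def)
      qed
    }
  qed
qed

end
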